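(* For all graphs $G$ and $H$, $$\operatorname{tw}(G\,\square\, H)\geq \tfrac{1}{2}(\operatorname{tw}(G)+1)(\operatorname{tw}(H)+1)-1.$$
   Context: All graphs are simple, finite and undirected. A tree-decomposition of a graph $G$ is a pair $(T,\beta)$ consisting of a tree $T$ and a function $\beta:V(T)\to 2^{V(G)}$ such that (i) for every $v\in V(G)$, the set $\{t\in V(T): v\in\beta(t)\}$ is non-empty and induces a connected subgraph of $T$; and (ii) for every edge $uv\in E(G)$ there is $t\in V(T)$ with $\{u,v\}\subseteq\beta(t)$. Its width is $\max_{t\in V(T)}|\beta(t)|-1$. The treewidth $\operatorname{tw}(G)$ is the minimum width of a tree-decomposition of $G$. The Cartesian product $G\,\square\, H$ is the graph with vertex set $V(G)\times V(H)$, where $(g_1,h_1)(g_2,h_2)$ is an edge if and only if $g_1=g_2$ and $h_1h_2\in E(H)$; or $g_1g_2\in E(G)$ and $h_1=h_2$. *)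

theory Defs
  imports Complex_Main "Graph_Theory.Graph_Theory"
begin

text \<open>
  A finite simple undirected graph is a \<^locale>\<open>pair_graph\<close>: each edge is represented by its two
  opposite arcs. The graph without vertices is allowed.
\<close>

text \<open>
  The library's \<^const>\<open>tree\<close> is unsuitable here: it forbids directed cycles only, so a pair
  of opposite arcs counts as a cycle, whereas an acyclically oriented triangle counts as a tree.
  In a \<^locale>\<open>pair_graph\<close> the cycles of the undirected graph are the
  \<^const>\<open>pre_digraph.cycle\<close>s of length at least three. The predicate
  \<^const>\<open>connected\<close> includes non-emptiness.
\<close>

definition undirected_tree :: "'t pair_pre_digraph \<Rightarrow> bool" where
  "undirected_tree T \<longleftrightarrow> pair_graph T \<and> connected (with_proj T) \<and>
     \<not> (\<exists>p. pre_digraph.cycle (with_proj T) p \<and> 3 \<le> length p)"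

definition tree_decomposition ::
  "'a pair_pre_digraph \<Rightarrow> 't pair_pre_digraph \<Rightarrow> ('t \<Rightarrow> 'a set) \<Rightarrow> bool" where
  "tree_decomposition G T \<beta> \<longleftrightarrow>
     undirected_tree T \<and>
     (\<forall>t\<in>pverts T. \<beta> t \<subseteq> pverts G) \<and>
     (\<forall>v\<in>pverts G. {t \<in> pverts T. v \<in> \<beta> t} \<noteq> {} \<and>
        connected (with_proj T \<restriction> {t \<in> pverts T. v \<in> \<beta> t})) \<and>
     (\<forall>(u, v)\<in>parcs G. \<exists>t\<in>pverts T. {u, v} \<subseteq> \<beta> t)"

definition decomposition_width :: "'t pair_pre_digraph \<Rightarrow> ('t \<Rightarrow> 'a set) \<Rightarrow> int" where
  "decomposition_width T \<beta> = (MAX t\<in>pverts T. int (card (\<beta> t))) - 1"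

text \<open>
  The treewidth is integer-valued since the graph without vertices has treewidth \<open>-1\<close>.
  Taking the tree nodes to be natural numbers is no restriction, as trees are finite; see
  \<open>treewidth_le\<close> below.
\<close>

definition treewidth :: "'a pair_pre_digraph \<Rightarrow> int" where
  "treewidth G = (LEAST w. \<exists>(T :: nat pair_pre_digraph) \<beta>.
     tree_decomposition G T \<beta> \<and> w = decomposition_width T \<beta>)"

definition cartesian_product ::
  "'a pair_pre_digraph \<Rightarrow> 'b pair_pre_digraph \<Rightarrow> ('a \<times> 'b) pair_pre_digraph"  (infixr \<open>\<box>\<close> 70) where
  "G \<box> H = \<lparr> pverts = pverts G \<times> pverts H,
     parcs = {((g1, h1), (g2, h2)).
       g1 = g2 \<and> g1 \<in> pverts G \<and> (h1, h2) \<in> parcs H \<or>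
       (g1, g2) \<in> parcs G \<and> h1 = h2 \<and> h1 \<in> pverts H} \<rparr>"

lemma pair_graph_cartesian_product:
  assumes "pair_graph G" and "pair_graph H"
  shows "pair_graph (G \<box> H)"
proof -
  interpret G: pair_graph G by fact
  interpret H: pair_graph H by fact
  have sub: "parcs (G \<box> H) \<subseteq> (pverts G \<times> pverts H) \<times> (pverts G \<times> pverts H)"
    using G.arc_fst_in_verts G.arc_snd_in_verts H.arc_fst_in_verts H.arc_snd_in_verts
    by (fastforce simp: cartesian_product_def)
  have fin: "finite (pverts G \<times> pverts H)"
    using G.pair_finite_verts H.pair_finite_verts by simp
  have sG: "(x, y) \<in> parcs G \<Longrightarrow> (y, x) \<in> parcs G" for x y
    using G.pair_sym_arcs by (auto simp: symmetric_def sym_def)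
  have sH: "(x, y) \<in> parcs H \<Longrightarrow> (y, x) \<in> parcs H" for x y
    using H.pair_sym_arcs by (auto simp: symmetric_def sym_def)
  show ?thesis
  proof
    show "finite (pverts (G \<box> H))" using fin by (simp add: cartesian_product_def)
    show "finite (parcs (G \<box> H))" using sub fin by (meson finite_SigmaI finite_subset)
    show "fst e \<in> pverts (G \<box> H)" "snd e \<in> pverts (G \<box> H)" if "e \<in> parcs (G \<box> H)" for e
      using subsetD[OF sub that] by (auto simp: cartesian_product_def)
    show "fst e \<noteq> snd e" if "e \<in> parcs (G \<box> H)" for e
      using that G.pair_no_loops H.pair_no_loops by (fastforce simp: cartesian_product_def)
    show "symmetric (with_proj (G \<box> H))"
      using sG sH by (auto simp: symmetric_def sym_def cartesian_product_def)
  qed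
qed

lemma decomposition_width_ge:
  assumes "tree_decomposition G T \<beta>"
  shows "- 1 \<le> decomposition_width T \<beta>"
proof -
  have "finite (pverts T)" "pverts T \<noteq> {}"
    using assms by (auto simp: tree_decomposition_def undirected_tree_def connected_conv
        pair_graph_def pair_digraph_def pair_fin_digraph_def pair_fin_digraph_axioms_def)
  then obtain t where "t \<in> pverts T" by blast
  then have "int (card (\<beta> t)) \<le> (MAX t\<in>pverts T. int (card (\<beta> t)))"
    using \<open>finite (pverts T)\<close> by simp
  then show ?thesis by (simp add: decomposition_width_def)
qed

lemma tree_decomposition_exists:
  assumes "pair_graph G"
  shows "\<exists>(T :: nat pair_pre_digraph) \<beta>. tree_decomposition G T \<beta>"
proof -
  interpret G: pair_graph G by fact
  let ?T = "\<lparr> pverts = {0 :: nat}, parcs = {} \<rparr>"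
  have "pair_graph ?T"
    by unfold_locales (auto simp: symmetric_def sym_def)
  moreover have "connected (with_proj ?T)"
    by (auto simp: connected_conv)
  moreover have "\<not> pre_digraph.cycle (with_proj ?T) p" for p
    by (auto simp: pre_digraph.cycle_def pre_digraph.awalk_def)
  ultimately have "undirected_tree ?T" by (simp add: undirected_tree_def)
  moreover have "connected (with_proj ?T \<restriction> {0})"
    by (auto simp: connected_conv)
  moreover have "x \<in> pverts G" "y \<in> pverts G" if "(x, y) \<in> parcs G" for x y
    using G.arc_fst_in_verts[OF that] G.arc_snd_in_verts[OF that] by simp_all
  ultimately have "tree_decomposition G ?T (\<lambda>_. pverts G)"
    by (auto simp: tree_decomposition_def)
  then show ?thesis by blast
qed

lemma Least_int_bounded:
  fixes P :: "int \<Rightarrow> bool"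
  assumes "P k" and "\<And>w. P w \<Longrightarrow> b \<le> w"
  shows "P (Least P)" and "\<And>w. P w \<Longrightarrow> Least P \<le> w"
proof -
  define n where "n = (LEAST n. P (b + int n))"
  have "P (b + int (nat (k - b)))" using assms by simp
  then have n: "P (b + int n)" unfolding n_def by (rule LeastI)
  have le: "b + int n \<le> w" if "P w" for w
  proof -
    have "P (b + int (nat (w - b)))" using assms(2) that by simp
    then have "n \<le> nat (w - b)" unfolding n_def by (rule Least_le)
    then show ?thesis using assms(2)[OF that] by linarith
  qed
  have "Least P = b + int n" using n le by (rule Least_equality)
  then show "P (Least P)" and "\<And>w. P w \<Longrightarrow> Least P \<le> w" using n le by simp_all
qed

lemma treewidth_attained:
  assumes "pair_graph G"
  obtains T :: "nat pair_pre_digraph" and \<beta>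
  where "tree_decomposition G T \<beta>" and "treewidth G = decomposition_width T \<beta>"
proof -
  define P where "P w \<longleftrightarrow> (\<exists>(T :: nat pair_pre_digraph) \<beta>.
     tree_decomposition G T \<beta> \<and> w = decomposition_width T \<beta>)" for w
  obtain T :: "nat pair_pre_digraph" and \<beta> where "tree_decomposition G T \<beta>"
    using tree_decomposition_exists[OF assms] by blast
  then have P: "P (decomposition_width T \<beta>)" by (auto simp: P_def)
  have ge: "- 1 \<le> w" if "P w" for w
    using that decomposition_width_ge by (auto simp: P_def)
  have "P (Least P)" using P ge by (rule Least_int_bounded(1))
  moreover have "treewidth G = Least P" by (simp add: treewidth_def P_def[abs_def])
  ultimately have "P (treewidth G)" by simp
  then show ?thesis unfolding P_def using that by blast
qed

lemma treewidth_le_nat: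
  fixes T :: "nat pair_pre_digraph"
  assumes "tree_decomposition G T \<beta>"
  shows "treewidth G \<le> decomposition_width T \<beta>"
proof -
  define P where "P w \<longleftrightarrow> (\<exists>(T :: nat pair_pre_digraph) \<beta>.
     tree_decomposition G T \<beta> \<and> w = decomposition_width T \<beta>)" for w
  have P: "P (decomposition_width T \<beta>)" using assms by (auto simp: P_def)
  have ge: "- 1 \<le> w" if "P w" for w
    using that decomposition_width_ge by (auto simp: P_def)
  have "Least P \<le> decomposition_width T \<beta>" using P ge P by (rule Least_int_bounded(2))
  moreover have "treewidth G = Least P" by (simp add: treewidth_def P_def[abs_def])
  ultimately show ?thesis by simp
qed

lemma pcas_map:
  "pcas u p v \<Longrightarrow> pcas (g u) (map (map_prod g g) p) (g v)"
  by (induction p arbitrary: u) auto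

lemma pawalk_verts_map:
  "pawalk_verts (g u) (map (map_prod g g) p) = map g (pawalk_verts u p)"
  by (induction p arbitrary: u) auto

lemma connected_image:
  assumes "connected G" and "verts H = f ` verts G"
    and "\<And>x y. x \<in> verts G \<Longrightarrow> y \<in> verts G \<Longrightarrow> (x, y) \<in> arcs_ends G \<Longrightarrow> (f x, f y) \<in> arcs_ends H"
  shows "connected H"
proof -
  have "(f x, f y) \<in> rtrancl_on (verts H) ((arcs_ends H)\<^sup>s)"
    if "(x, y) \<in> rtrancl_on (verts G) ((arcs_ends G)\<^sup>s)" for x y
    using that
  proof (induction rule: rtrancl_on_induct)
    case base
    then show ?case using assms(2) by simp
  next
    case (step y z)
    then have "(f y, f z) \<in> (arcs_ends H)\<^sup>s" "f z \<in> verts H"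
      using assms(2,3) by (auto simp: symcl_def)
    with step.IH show ?case by (rule rtrancl_on_into_rtrancl_on)
  qed
  with assms(1,2) show ?thesis by (auto simp: connected_conv)
qed

text \<open>Relabelling the nodes of the tree shows that the choice of node type is immaterial.\<close>

lemma treewidth_le:
  fixes T :: "'t pair_pre_digraph"
  assumes td: "tree_decomposition G T \<beta>"
  shows "treewidth G \<le> decomposition_width T \<beta>"
proof -
  have pg: "pair_graph T" and conn: "connected (with_proj T)"
    and acyc: "\<And>p. pre_digraph.cycle (with_proj T) p \<Longrightarrow> \<not> 3 \<le> length p"
    using td by (auto simp: tree_decomposition_def undirected_tree_def)
  interpret T: pair_graph T by fact
  obtain f :: "'t \<Rightarrow> nat" where f: "inj_on f (pverts T)"
    using finite_imp_inj_to_nat_seg[OF T.pair_finite_verts] by blast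
  define g where "g = inv_into (pverts T) f"
  have gf: "g (f x) = x" if "x \<in> pverts T" for x
    using f that by (simp add: g_def)
  define T' where "T' = \<lparr> pverts = f ` pverts T, parcs = map_prod f f ` parcs T \<rparr>"
  have in_verts: "x \<in> pverts T" "y \<in> pverts T" if "(x, y) \<in> parcs T" for x y
    using T.arc_fst_in_verts[OF that] T.arc_snd_in_verts[OF that] by simp_all
  have symT: "(y, x) \<in> parcs T" if "(x, y) \<in> parcs T" for x y
    using T.pair_sym_arcs that by (auto simp: symmetric_def sym_def)
  have pg': "pair_graph T'"
  proof
    show "finite (pverts T')" "finite (parcs T')"
      using T.pair_finite_verts T.pair_finite_arcs by (auto simp: T'_def)
    show "fst e \<in> pverts T'" "snd e \<in> pverts T'" if "e \<in> parcs T'" for e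
      using that in_verts by (auto simp: T'_def)
    show "fst e \<noteq> snd e" if e: "e \<in> parcs T'" for e
    proof -
      from e obtain x y where xy: "(x, y) \<in> parcs T" "e = (f x, f y)" by (auto simp: T'_def)
      then show ?thesis using f in_verts T.pair_no_loops by (fastforce dest: inj_onD)
    qed
    show "symmetric (with_proj T')"
      using symT by (force simp: symmetric_def sym_def T'_def)
  qed
  have conn': "connected (with_proj T')"
    using conn by (rule connected_image[where f = f]) (auto simp: T'_def)
  have acyc': "\<not> 3 \<le> length p" if c: "pre_digraph.cycle (with_proj T') p" for p
  proof -
    obtain u where u: "u \<in> pverts T'" "set p \<subseteq> parcs T'" "pcas u p u"
      "distinct (tl (pawalk_verts u p))" "p \<noteq> []"
      using c by (auto simp: pre_digraph.cycle_def pre_digraph.awalk_def)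
    let ?q = "map (map_prod g g) p"
    have "set (pawalk_verts u p) \<subseteq> pverts T'"
      using u(1,2)
    proof (induction p arbitrary: u)
      case (Cons e p)
      have "fst e \<in> pverts T'" "snd e \<in> pverts T'"
        using Cons.prems(2) in_verts by (auto simp: T'_def)
      then show ?case using Cons by simp
    qed simp
    then have "set (tl (pawalk_verts u p)) \<subseteq> f ` pverts T"
      by (cases "pawalk_verts u p") (auto simp: T'_def)
    then have "inj_on g (set (tl (pawalk_verts u p)))"
      by (metis g_def inj_on_inv_into)
    then have "distinct (tl (pawalk_verts (g u) ?q))"
      using u(4) by (simp add: pawalk_verts_map map_tl[symmetric] distinct_map)
    moreover have "pcas (g u) ?q (g u)" using u(3) by (rule pcas_map)
    moreover have "map_prod g g e \<in> parcs T" if "e \<in> parcs T'" for e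
      using that in_verts gf by (auto simp: T'_def)
    then have "set ?q \<subseteq> parcs T" using u(2) by auto
    moreover have "g u \<in> pverts T" using u(1) gf by (auto simp: T'_def)
    ultimately have "pre_digraph.cycle (with_proj T) ?q"
      using u(5) by (auto simp: pre_digraph.cycle_def pre_digraph.awalk_def
          cas_with_proj_eq awalk_verts_with_proj_eq)
    then show ?thesis using acyc by fastforce
  qed
  have bag: "{t \<in> pverts T'. v \<in> \<beta> (g t)} = f ` {t \<in> pverts T. v \<in> \<beta> t}" for v
    using gf by (auto simp: T'_def)
  have "tree_decomposition G T' (\<beta> \<circ> g)"
    unfolding tree_decomposition_def
  proof (intro conjI ballI)
    show "undirected_tree T'" using pg' conn' acyc' by (auto simp: undirected_tree_def)
    show "(\<beta> \<circ> g) t \<subseteq> pverts G" if "t \<in> pverts T'" for t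
      using that td gf by (fastforce simp: T'_def tree_decomposition_def)
    fix v assume v: "v \<in> pverts G"
    show "{t \<in> pverts T'. v \<in> (\<beta> \<circ> g) t} \<noteq> {}"
      using v td by (simp add: bag tree_decomposition_def)
    have "connected (with_proj T \<restriction> {t \<in> pverts T. v \<in> \<beta> t})"
      using v td by (simp add: tree_decomposition_def)
    then show "connected (with_proj T' \<restriction> {t \<in> pverts T'. v \<in> (\<beta> \<circ> g) t})"
      by (rule connected_image[where f = f])
        (use bag[of v] gf in \<open>force simp: T'_def arcs_ends_conv\<close>)+
  next
    fix e assume "e \<in> parcs G"
    then show "case e of (u, v) \<Rightarrow> \<exists>t\<in>pverts T'. {u, v} \<subseteq> (\<beta> \<circ> g) t"
      using td gf by (fastforce simp: T'_def tree_decomposition_def)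
  qed
  then have "treewidth G \<le> decomposition_width T' (\<beta> \<circ> g)" by (rule treewidth_le_nat)
  also have "(\<lambda>t. int (card ((\<beta> \<circ> g) t))) ` pverts T' = (\<lambda>t. int (card (\<beta> t))) ` pverts T"
    using gf by (force simp: T'_def)
  then have "decomposition_width T' (\<beta> \<circ> g) = decomposition_width T \<beta>"
    by (simp add: decomposition_width_def)
  finally show ?thesis .
qed

end

theory Submission
  imports Defs
begin

text \<open>
  Let \<open>l = tw(H) + 1\<close>. By bramble duality \<open>H\<close> has a bramble all of whose covers have at least \<open>l\<close>
  elements. Given a tree-decomposition \<open>(T, \<beta>)\<close> of \<open>G \<box> H\<close>, for every vertex \<open>g\<close> of \<open>G\<close> the Helly
  property of subtrees yields a node whose bag covers the copy of the bramble in \<open>{g} \<times> H\<close>. Let \<open>R g\<close>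
  be the subtree reached from this node along edges whose adhesion set has at least \<open>l / 2\<close> elements
  in \<open>{g} \<times> H\<close>. If \<open>g g'\<close> is an edge of \<open>G\<close>, then \<open>R g\<close> and \<open>R g'\<close> meet: otherwise two adhesion sets
  with together fewer than \<open>l\<close> elements would separate \<open>{g} \<times> B\<close> from \<open>{g'} \<times> B\<close> for some member \<open>B\<close> of
  the bramble. Hence the sets \<open>{g. t \<in> R g}\<close> are the bags of a tree-decomposition of \<open>G\<close> over \<open>T\<close>. As
  each \<open>g\<close> in the bag of \<open>t\<close> accounts for at least \<open>l / 2\<close> elements of \<open>\<beta> t\<close>, the largest bag of \<open>\<beta>\<close>
  has at least \<open>(tw(G) + 1) l / 2\<close> elements.
\<close>

section \<open>Connected sets and trees\<close>

text \<open>The cut form hands over an edge that leaves a given set, which is how most arguments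
  below use connectedness. The empty set counts as connected, so non-emptiness is demanded
  separately where it matters.\<close>

definition conn :: "'a rel \<Rightarrow> 'a set \<Rightarrow> bool" where
  "conn E A \<longleftrightarrow> (\<forall>U\<subseteq>A. U \<noteq> {} \<longrightarrow> U \<noteq> A \<longrightarrow> (\<exists>x\<in>U. \<exists>y\<in>A - U. (x, y) \<in> E))"

lemma connD:
  assumes "conn E A" "x \<in> A" "x \<in> U" "y \<in> A" "y \<notin> U"
  obtains p q where "p \<in> A" "p \<in> U" "q \<in> A" "q \<notin> U" "(p, q) \<in> E"
proof -
  have "A \<inter> U \<subseteq> A" "A \<inter> U \<noteq> {}" "A \<inter> U \<noteq> A" using assms by auto
  then obtain p q where "p \<in> A \<inter> U" "q \<in> A - A \<inter> U" "(p, q) \<in> E"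
    using assms(1) unfolding conn_def by meson
  then show ?thesis using that by blast
qed

lemma conn_empty [simp]: "conn E {}" and conn_singleton [simp]: "conn E {x}"
  by (auto simp: conn_def)

lemma conn_mono: "conn E A \<Longrightarrow> E \<subseteq> E' \<Longrightarrow> conn E' A"
  unfolding conn_def by blast

lemma conn_reach:
  assumes "sym E" and "\<And>x. x \<in> A \<Longrightarrow> (c, x) \<in> (E \<inter> A \<times> A)\<^sup>*"
  shows "conn E A"
  unfolding conn_def
proof (intro allI impI)
  fix U assume U: "U \<subseteq> A" "U \<noteq> {}" "U \<noteq> A"
  have cross: "\<exists>p\<in>A. \<exists>q\<in>A. p \<in> P \<and> q \<notin> P \<and> (p, q) \<in> E"
    if "c \<in> P" "x \<in> A" "x \<notin> P" for P x
  proof (rule ccontr)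
    assume no: "\<not> ?thesis"
    have "(c, x) \<in> (E \<inter> A \<times> A)\<^sup>*" using assms(2) that by simp
    then have "x \<in> P"
      by (induction rule: rtrancl_induct) (use \<open>c \<in> P\<close> no in auto)
    then show False using that by simp
  qed
  show "\<exists>x\<in>U. \<exists>y\<in>A - U. (x, y) \<in> E"
  proof (cases "c \<in> U")
    case True
    with U cross[of U] show ?thesis by blast
  next
    case False
    with U cross[of "- U"] have "\<exists>p\<in>A. \<exists>q\<in>A. p \<notin> U \<and> q \<in> U \<and> (p, q) \<in> E" by blast
    then show ?thesis using \<open>sym E\<close> by (blast dest: symD)
  qed
qed

lemma conn_Un:
  assumes "sym E" "conn E A" "conn E B" "A \<inter> B \<noteq> {}"
  shows "conn E (A \<union> B)"
  unfolding conn_def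
proof (intro allI impI)
  fix U assume U: "U \<subseteq> A \<union> B" "U \<noteq> {}" "U \<noteq> A \<union> B"
  have *: "\<exists>x\<in>U. \<exists>y\<in>(A \<union> B) - U. (x, y) \<in> E"
    if "conn E P" "P \<subseteq> A \<union> B" "p \<in> P" "p \<in> U" "q \<in> P" "q \<notin> U" for P p q
    by (rule connD[OF that(1) that(3-6)]) (use that(2) in blast)
  obtain z where z: "z \<in> A" "z \<in> B" using assms by blast
  obtain p q where "p \<in> U" "q \<in> A \<union> B" "q \<notin> U" using U by blast
  have "p \<in> A \<union> B" using U \<open>p \<in> U\<close> by blast
  show "\<exists>x\<in>U. \<exists>y\<in>(A \<union> B) - U. (x, y) \<in> E" (is ?Q)
  proof (cases "z \<in> U")
    case True
    with \<open>q \<in> A \<union> B\<close> show ?Q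
      using *[OF \<open>conn E A\<close> Un_upper1 z(1) _ _ \<open>q \<notin> U\<close>]
        *[OF \<open>conn E B\<close> Un_upper2 z(2) _ _ \<open>q \<notin> U\<close>] by (elim UnE) simp_all
  next
    case False
    with \<open>p \<in> A \<union> B\<close> show ?Q
      using *[OF \<open>conn E A\<close> Un_upper1 _ \<open>p \<in> U\<close> z(1)]
        *[OF \<open>conn E B\<close> Un_upper2 _ \<open>p \<in> U\<close> z(2)] by (elim UnE) simp_all
  qed
qed

lemma conn_pair:
  assumes "(x, y) \<in> E" "(y, x) \<in> E"
  shows "conn E {x, y}"
  unfolding conn_def
proof (intro allI impI)
  fix U assume "U \<subseteq> {x, y}" "U \<noteq> {}" "U \<noteq> {x, y}"
  then have "U = {x} \<and> x \<noteq> y \<or> U = {y} \<and> x \<noteq> y" by blast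
  then show "\<exists>a\<in>U. \<exists>b\<in>{x, y} - U. (a, b) \<in> E" using assms by auto
qed

definition component :: "'a rel \<Rightarrow> 'a set \<Rightarrow> 'a \<Rightarrow> 'a set" where
  "component E A c = {x. (c, x) \<in> (E \<inter> A \<times> A)\<^sup>*}"

lemma component_self [simp]: "c \<in> component E A c"
  by (simp add: component_def)

lemma component_subset: "c \<in> A \<Longrightarrow> component E A c \<subseteq> A"
  by (auto simp: component_def elim: rtranclE)

lemma component_step:
  "x \<in> component E A c \<Longrightarrow> (x, y) \<in> E \<Longrightarrow> x \<in> A \<Longrightarrow> y \<in> A \<Longrightarrow> y \<in> component E A c"
  by (auto simp: component_def intro: rtrancl_into_rtrancl)

lemma conn_component:
  assumes "sym E"
  shows "conn E (component E A c)"
proof (rule conn_reach[OF assms])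
  fix x assume "x \<in> component E A c"
  then have "(c, x) \<in> (E \<inter> A \<times> A)\<^sup>*" by (simp add: component_def)
  then show "(c, x) \<in> (E \<inter> component E A c \<times> component E A c)\<^sup>*"
  proof (induction rule: rtrancl_induct)
    case (step y z)
    then have "y \<in> component E A c" "z \<in> component E A c"
      by (auto simp: component_def intro: rtrancl_into_rtrancl)
    with step show ?case by (auto intro: rtrancl_into_rtrancl)
  qed simp
qed

text \<open>For symmetric \<open>F\<close>, the last clause says that every edge is a bridge: \<open>S\<close> is the side of \<open>a\<close>
  after removing the edge \<open>ab\<close>.\<close>

definition ctree :: "'t set \<Rightarrow> 't rel \<Rightarrow> bool" where
  "ctree N F \<longleftrightarrow> finite N \<and> N \<noteq> {} \<and> F \<subseteq> N \<times> N \<and> sym F \<and> conn F N \<and>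
     (\<forall>a b. (a, b) \<in> F \<longrightarrow> (\<exists>S. a \<in> S \<and> b \<notin> S \<and> (\<forall>x y. (x, y) \<in> F \<longrightarrow> x \<in> S \<longrightarrow> y \<notin> S \<longrightarrow> x = a \<and> y = b)))"

lemma ctreeD:
  assumes "ctree N F"
  shows "finite N" "N \<noteq> {}" "F \<subseteq> N \<times> N" "sym F" "conn F N"
  using assms by (auto simp: ctree_def)

text \<open>Since \<open>ab\<close> is the only edge that leaves \<open>S\<close>, a connected set
  containing just one of its ends cannot cross the border of \<open>S\<close>. This is how
  acyclicity enters the later arguments.\<close>

lemma ctree_cut:
  assumes "ctree N F" "(a, b) \<in> F"
  obtains S where "a \<in> S" "b \<notin> S"
    "\<And>x y. (x, y) \<in> F \<Longrightarrow> x \<in> S \<Longrightarrow> y \<notin> S \<Longrightarrow> x = a \<and> y = b"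
    "\<And>A. conn F A \<Longrightarrow> a \<in> A \<Longrightarrow> b \<notin> A \<Longrightarrow> A \<subseteq> S"
    "\<And>A. conn F A \<Longrightarrow> b \<in> A \<Longrightarrow> a \<notin> A \<Longrightarrow> A \<inter> S = {}"
proof -
  have "\<exists>S. a \<in> S \<and> b \<notin> S \<and> (\<forall>x y. (x, y) \<in> F \<longrightarrow> x \<in> S \<longrightarrow> y \<notin> S \<longrightarrow> x = a \<and> y = b)"
    using assms unfolding ctree_def by simp
  then obtain S where S: "a \<in> S" "b \<notin> S"
    "\<And>x y. (x, y) \<in> F \<Longrightarrow> x \<in> S \<Longrightarrow> y \<notin> S \<Longrightarrow> x = a \<and> y = b"
    by auto
  show ?thesis
  proof (rule that[OF S])
    fix A assume "conn F A" "a \<in> A" "b \<notin> A"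
    show "A \<subseteq> S"
    proof
      fix z assume "z \<in> A"
      show "z \<in> S"
      proof (rule ccontr)
        assume "z \<notin> S"
        obtain p q where "q \<in> A" "p \<in> S" "q \<notin> S" "(p, q) \<in> F"
          using connD[OF \<open>conn F A\<close> \<open>a \<in> A\<close> S(1) \<open>z \<in> A\<close> \<open>z \<notin> S\<close>] .
        then show False using S(3) \<open>b \<notin> A\<close> by blast
      qed
    qed
  next
    fix A assume "conn F A" "b \<in> A" "a \<notin> A"
    show "A \<inter> S = {}"
    proof (rule ccontr)
      assume "A \<inter> S \<noteq> {}"
      then obtain z where "z \<in> A" "z \<in> S" by blast
      obtain p q where "p \<in> A" "p \<in> S" "q \<notin> S" "(p, q) \<in> F"
        using connD[OF \<open>conn F A\<close> \<open>z \<in> A\<close> \<open>z \<in> S\<close> \<open>b \<in> A\<close> S(2)] .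
      then show False using S(3) \<open>a \<notin> A\<close> by blast
    qed
  qed
qed

section \<open>Intersections of subtrees and the Helly property\<close>

text \<open>If the component \<open>C\<close> of \<open>x\<close> in \<open>A \<inter> B\<close>
  missed \<open>y\<close>, some edge within \<open>A\<close> would lead from a node \<open>b\<close>
  of the component \<open>D\<close> of \<open>y\<close> in \<open>A - C\<close> to a node
  \<open>a\<close> of \<open>C\<close>. Then \<open>b\<close> is outside \<open>B\<close>, or
  \<open>C\<close> would absorb it. Cutting \<open>ab\<close> leaves \<open>B\<close> on the side of
  \<open>a\<close> and \<open>D\<close> on the side of \<open>b\<close>, yet \<open>y\<close> lies
  in both.\<close>

lemma ctree_Int_conn:
  assumes T: "ctree N F" and A: "conn F A" and B: "conn F B"
  shows "conn F (A \<inter> B)"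
proof (cases "A \<inter> B = {}")
  case False
  then obtain x where x: "x \<in> A" "x \<in> B" by blast
  note F = ctreeD[OF T]
  define C where "C = component F (A \<inter> B) x"
  have CAB: "C \<subseteq> A \<inter> B" unfolding C_def using x by (intro component_subset) simp
  have "A \<inter> B \<subseteq> C"
  proof
    fix y assume y: "y \<in> A \<inter> B"
    show "y \<in> C"
    proof (rule ccontr)
      assume yC: "y \<notin> C"
      define D where "D = component F (A - C) y"
      have D: "D \<subseteq> A - C" unfolding D_def using y yC by (intro component_subset) simp
      have yD: "y \<in> D" and cD: "conn F D" by (auto simp: D_def F intro: conn_component)
      have xC: "x \<in> C" by (simp add: C_def)
      obtain b a where ba: "b \<in> A" "b \<in> D" "a \<in> A" "a \<notin> D" "(b, a) \<in> F"
        using connD[OF A, of y D x] y yD x xC D by blast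
      have aC: "a \<in> C"
        using ba component_step[of b F "A - C" y a] D unfolding D_def by blast
      have ab: "(a, b) \<in> F" using ba F(4) by (blast dest: symD)
      have bB: "b \<notin> B"
        using component_step[of a F "A \<inter> B" x b] aC ab CAB ba D unfolding C_def by blast
      obtain S where S: "\<And>A. conn F A \<Longrightarrow> a \<in> A \<Longrightarrow> b \<notin> A \<Longrightarrow> A \<subseteq> S"
        "\<And>A. conn F A \<Longrightarrow> b \<in> A \<Longrightarrow> a \<notin> A \<Longrightarrow> A \<inter> S = {}"
        using ctree_cut[OF T ab] by metis
      have "B \<subseteq> S" using S(1)[OF B _ bB] aC CAB by blast
      moreover have "D \<inter> S = {}" using S(2)[OF cD ba(2,4)] .
      ultimately show False using y yD by blast
    qed
  qed
  then have "A \<inter> B = C" using CAB by blast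
  then show ?thesis using conn_component[OF F(4)] unfolding C_def by metis
qed simp

text \<open>The set \<open>(A \<union> B) \<inter> C\<close> is connected. Without a common node it
  contains an edge \<open>ab\<close> from \<open>A \<inter> C\<close> to \<open>B \<inter> C\<close>
  with \<open>a\<close> outside \<open>B\<close> and \<open>b\<close> outside \<open>A\<close>;
  cutting it would separate \<open>A\<close> from \<open>B\<close>.\<close>

lemma ctree_Int3:
  assumes T: "ctree N F" and conn: "conn F A" "conn F B" "conn F C"
    and meet: "A \<inter> B \<noteq> {}" "A \<inter> C \<noteq> {}" "B \<inter> C \<noteq> {}"
  shows "A \<inter> B \<inter> C \<noteq> {}"
proof
  assume none: "A \<inter> B \<inter> C = {}"
  have "conn F ((A \<union> B) \<inter> C)"
    using ctree_Int_conn[OF T conn_Un[OF ctreeD(4)[OF T] conn(1,2) meet(1)] conn(3)] .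
  moreover obtain p q where "p \<in> A \<inter> C" "q \<in> B \<inter> C" using meet by blast
  moreover from calculation have "q \<notin> A" using none by blast
  ultimately obtain a b where "a \<in> A" "a \<in> (A \<union> B) \<inter> C" "b \<in> (A \<union> B) \<inter> C" "b \<notin> A" "(a, b) \<in> F"
    using connD[of F "(A \<union> B) \<inter> C" p A q] by (metis IntE IntI UnI1 UnI2)
  then have ab: "a \<in> A \<inter> C" "b \<in> B \<inter> C" "(a, b) \<in> F" by blast+
  obtain S where S: "\<And>A. conn F A \<Longrightarrow> a \<in> A \<Longrightarrow> b \<notin> A \<Longrightarrow> A \<subseteq> S"
    "\<And>A. conn F A \<Longrightarrow> b \<in> A \<Longrightarrow> a \<notin> A \<Longrightarrow> A \<inter> S = {}"
    using ctree_cut[OF T ab(3)] by metis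
  have "A \<subseteq> S" using S(1)[OF conn(1)] ab none by blast
  moreover have "B \<inter> S = {}" using S(2)[OF conn(2)] ab none by blast
  ultimately show False using meet by blast
qed

text \<open>The members are absorbed into \<open>A\<close> one by one; the case of three subtrees
  ensures that the remaining members still meet the shrunken \<open>A\<close>.\<close>

lemma ctree_Helly:
  assumes T: "ctree N F" and "finite \<F>" and "conn F A" and "A \<noteq> {}"
    and "\<And>B. B \<in> \<F> \<Longrightarrow> conn F B \<and> A \<inter> B \<noteq> {}"
    and "\<And>B C. B \<in> \<F> \<Longrightarrow> C \<in> \<F> \<Longrightarrow> B \<inter> C \<noteq> {}"
  shows "A \<inter> \<Inter>\<F> \<noteq> {}"
  using assms(2-)
proof (induction \<F> arbitrary: A rule: finite_induct)
  case empty
  then show ?case by simp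
next
  case (insert B \<F>)
  have "(A \<inter> B) \<inter> \<Inter>\<F> \<noteq> {}"
  proof (rule insert.IH)
    show "conn F (A \<inter> B)" using insert.prems ctree_Int_conn[OF T] by blast
    show "A \<inter> B \<noteq> {}" using insert.prems by blast
    show "conn F C \<and> A \<inter> B \<inter> C \<noteq> {}" if "C \<in> \<F>" for C
      using insert.prems that ctree_Int3[OF T, of A B C] by (meson insertI1 insertI2)
    show "C \<inter> D \<noteq> {}" if "C \<in> \<F>" "D \<in> \<F>" for C D
      using insert.prems that by blast
  qed
  then show ?case by (simp add: Int_assoc)
qed

section \<open>Tree-decompositions\<close>

text \<open>Edges count only between vertices of \<open>V\<close>, so a single relation
  \<open>E\<close> serves all induced subgraphs.\<close>

definition tdec :: "'a set \<Rightarrow> 'a rel \<Rightarrow> 't set \<Rightarrow> 't rel \<Rightarrow> ('t \<Rightarrow> 'a set) \<Rightarrow> bool" where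
  "tdec V E N F \<beta> \<longleftrightarrow> ctree N F \<and> (\<forall>t\<in>N. \<beta> t \<subseteq> V) \<and>
     (\<forall>v\<in>V. {t \<in> N. v \<in> \<beta> t} \<noteq> {} \<and> conn F {t \<in> N. v \<in> \<beta> t}) \<and>
     (\<forall>u\<in>V. \<forall>v\<in>V. (u, v) \<in> E \<longrightarrow> (\<exists>t\<in>N. u \<in> \<beta> t \<and> v \<in> \<beta> t))"

lemma tdecD:
  assumes "tdec V E N F \<beta>"
  shows "ctree N F" "\<And>t. t \<in> N \<Longrightarrow> \<beta> t \<subseteq> V"
    "\<And>v. v \<in> V \<Longrightarrow> \<exists>t\<in>N. v \<in> \<beta> t"
    "\<And>v. v \<in> V \<Longrightarrow> conn F {t \<in> N. v \<in> \<beta> t}"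
    "\<And>u v. u \<in> V \<Longrightarrow> v \<in> V \<Longrightarrow> (u, v) \<in> E \<Longrightarrow> \<exists>t\<in>N. u \<in> \<beta> t \<and> v \<in> \<beta> t"
  using assms unfolding tdec_def by blast+

text \<open>No vertex of \<open>B\<close> lies in both bags of an edge leaving \<open>U\<close>, so
  the subtree of each vertex of \<open>B\<close> stays on one side. Adjacent vertices share a bag
  and hence a side, and connectedness of \<open>B\<close> spreads this to all of
  \<open>B\<close>.\<close>

lemma tdec_separation:
  assumes td: "tdec V E N F \<beta>" and B: "B \<subseteq> V" "conn E B"
    and sep: "\<And>x y. x \<in> U \<Longrightarrow> y \<in> N - U \<Longrightarrow> (x, y) \<in> F \<Longrightarrow> \<beta> x \<inter> \<beta> y \<inter> B = {}"
  shows "{t \<in> N. \<beta> t \<inter> B \<noteq> {}} \<subseteq> U \<or> {t \<in> N. \<beta> t \<inter> B \<noteq> {}} \<inter> U = {}"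
proof -
  have one: "t' \<in> U"
    if v: "v \<in> B" and t: "t \<in> N" "v \<in> \<beta> t" "t \<in> U" and t': "t' \<in> N" "v \<in> \<beta> t'" for v t t'
  proof (rule ccontr)
    assume "t' \<notin> U"
    have "conn F {t \<in> N. v \<in> \<beta> t}" using tdecD(4)[OF td] v B by blast
    then obtain p q where "p \<in> {t \<in> N. v \<in> \<beta> t}" "p \<in> U" "q \<in> {t \<in> N. v \<in> \<beta> t}" "q \<notin> U" "(p, q) \<in> F"
      by (rule connD[of F _ t U t']) (use t t' \<open>t' \<notin> U\<close> in auto)
    then show False using sep[of p q] v by blast
  qed
  define B1 where "B1 = {v \<in> B. \<exists>t\<in>N. v \<in> \<beta> t \<and> t \<in> U}"
  show ?thesis
  proof (rule ccontr)
    assume no: "\<not> ?thesis"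
    from no obtain t u where t: "t \<in> N" "t \<in> U" "u \<in> \<beta> t" "u \<in> B" by blast
    from no obtain t' v where t': "t' \<in> N" "t' \<notin> U" "v \<in> \<beta> t'" "v \<in> B" by blast
    have "u \<in> B1" "v \<notin> B1" using t t' one by (auto simp: B1_def)
    obtain p q where pq: "p \<in> B" "p \<in> B1" "q \<in> B" "q \<notin> B1" "(p, q) \<in> E"
      by (rule connD[OF B(2) t(4) \<open>u \<in> B1\<close> t'(4) \<open>v \<notin> B1\<close>])
    then obtain s where s: "s \<in> N" "p \<in> \<beta> s" "q \<in> \<beta> s"
      using tdecD(5)[OF td, of p q] B(1) by blast
    obtain r where "r \<in> N" "p \<in> \<beta> r" "r \<in> U" using pq by (auto simp: B1_def)
    then have "s \<in> U" using one pq s by blast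
    then show False using pq s by (auto simp: B1_def)
  qed
qed

text \<open>A part \<open>U\<close> of the trace without edges to the rest of it satisfies
  \<open>tdec_separation\<close>: a vertex of \<open>B\<close> shared with a neighbouring bag would
  put that neighbour into the trace as well.\<close>

lemma tdec_trace_conn:
  assumes td: "tdec V E N F \<beta>" and B: "B \<subseteq> V" "conn E B"
  shows "conn F {t \<in> N. \<beta> t \<inter> B \<noteq> {}}" (is "conn F ?R")
  unfolding conn_def
proof (intro allI impI, rule ccontr)
  fix U assume U: "U \<subseteq> ?R" "U \<noteq> {}" "U \<noteq> ?R" and no: "\<not> (\<exists>x\<in>U. \<exists>y\<in>?R - U. (x, y) \<in> F)"
  have "?R \<subseteq> U \<or> ?R \<inter> U = {}"
    by (rule tdec_separation[OF assms]) (use no in blast)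
  then show False using U by blast
qed

section \<open>Joining, renaming and gluing of decompositions\<close>

lemma ctree_singleton: "ctree {t} {}"
  by (simp add: ctree_def sym_def)

lemma ctree_join:
  assumes T1: "ctree N1 F1" and T2: "ctree N2 F2" and disj: "N1 \<inter> N2 = {}"
    and a: "a \<in> N1" and b: "b \<in> N2"
  shows "ctree (N1 \<union> N2) (F1 \<union> F2 \<union> {(a, b), (b, a)})" (is "ctree ?N ?F")
    and "\<And>A1 A2. conn F1 A1 \<Longrightarrow> conn F2 A2 \<Longrightarrow> a \<in> A1 \<Longrightarrow> b \<in> A2 \<Longrightarrow>
      conn (F1 \<union> F2 \<union> {(a, b), (b, a)}) (A1 \<union> A2)"
proof -
  note 1 = ctreeD[OF T1] and 2 = ctreeD[OF T2]
  have s: "sym ?F" using 1(4) 2(4) by (auto simp: sym_def)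
  show c: "conn ?F (A1 \<union> A2)" if "conn F1 A1" "conn F2 A2" "a \<in> A1" "b \<in> A2" for A1 A2
  proof -
    have "conn ?F {a, b}" by (rule conn_pair) simp_all
    moreover have "conn ?F A1" "conn ?F A2" using that(1,2) by (auto elim: conn_mono)
    ultimately have "conn ?F ((A1 \<union> {a, b}) \<union> A2)"
      using s that(3,4) by (intro conn_Un) auto
    moreover have "(A1 \<union> {a, b}) \<union> A2 = A1 \<union> A2" using that by blast
    ultimately show ?thesis by simp
  qed
  have cut: "\<exists>S. x \<in> S \<and> y \<notin> S \<and> (\<forall>p q. (p, q) \<in> ?F \<longrightarrow> p \<in> S \<longrightarrow> q \<notin> S \<longrightarrow> p = x \<and> q = y)"
    if "(x, y) \<in> ?F" for x y
  proof -
    have ext: "\<exists>S. x \<in> S \<and> y \<notin> S \<and> (\<forall>p q. (p, q) \<in> Fa \<union> Fb \<union> {(c, d), (d, c)} \<longrightarrow> p \<in> S \<longrightarrow> q \<notin> S \<longrightarrow> p = x \<and> q = y)"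
      if T: "ctree Na Fa" and Fb: "Fb \<subseteq> Nb \<times> Nb" "Na \<inter> Nb = {}" "c \<in> Na" "d \<in> Nb" and xy: "(x, y) \<in> Fa"
      for Na Nb Fa Fb c d
    proof -
      obtain S where S: "x \<in> S" "y \<notin> S" "\<And>p q. (p, q) \<in> Fa \<Longrightarrow> p \<in> S \<Longrightarrow> q \<notin> S \<Longrightarrow> p = x \<and> q = y"
        using ctree_cut[OF T xy] by metis
      have Fa: "Fa \<subseteq> Na \<times> Na" using ctreeD(3)[OF T] .
      \<comment> \<open>A cut of one tree takes along the whole other tree exactly when it contains
        the attaching node \<open>c\<close>, so the new edge does not cross it.\<close>
      define S' where "S' = (S \<inter> Na) \<union> (if c \<in> S then Nb else {})"
      have "x \<in> S'" "y \<notin> S'" using S(1,2) subsetD[OF Fa xy] Fb(2) by (auto simp: S'_def)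
      moreover have "p = x \<and> q = y"
        if "(p, q) \<in> Fa \<union> Fb \<union> {(c, d), (d, c)}" "p \<in> S'" "q \<notin> S'" for p q
        using that S(3)[of p q] subsetD[OF Fa, of "(p, q)"] subsetD[OF Fb(1), of "(p, q)"] Fb(2-)
        by (auto simp: S'_def split: if_splits)
      ultimately show ?thesis by blast
    qed
    from that consider "(x, y) \<in> F1" | "(x, y) \<in> F2" | "x = a" "y = b" | "x = b" "y = a" by blast
    then show ?thesis
    proof cases
      case 1
      from ext[OF T1 2(3) disj a b this] show ?thesis .
    next
      case 2
      have F: "F2 \<union> F1 \<union> {(b, a), (a, b)} = ?F" by blast
      have "N2 \<inter> N1 = {}" using disj by blast
      from ext[OF T2 1(3) this b a 2] show ?thesis unfolding F .
    next
      \<comment> \<open>For the new edge itself, the node set of one of the two trees is the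
        cut.\<close>
      case 3
      then show ?thesis using a b disj 1(3) 2(3) by (intro exI[of _ N1]) blast
    next
      case 4
      then show ?thesis using a b disj 1(3) 2(3) by (intro exI[of _ N2]) blast
    qed
  qed
  show "ctree ?N ?F"
    unfolding ctree_def
  proof (intro conjI)
    show "conn ?F ?N" using c[OF 1(5) 2(5) a b] .
    show "\<forall>x y. (x, y) \<in> ?F \<longrightarrow> (\<exists>S. x \<in> S \<and> y \<notin> S \<and>
      (\<forall>p q. (p, q) \<in> ?F \<longrightarrow> p \<in> S \<longrightarrow> q \<notin> S \<longrightarrow> p = x \<and> q = y))" using cut by blast
  qed (use 1 2 a b s in auto)
qed

text \<open>A shared vertex lies in the bags of both \<open>a\<close> and \<open>b\<close>, so the
  new edge connects its two subtrees. Hypothesis \<open>E\<close> excludes edges between the private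
  parts of \<open>V1\<close> and \<open>V2\<close>.\<close>

lemma tdec_join:
  assumes td1: "tdec V1 E N1 F1 \<beta>1" and td2: "tdec V2 E N2 F2 \<beta>2" and disj: "N1 \<inter> N2 = {}"
    and a: "a \<in> N1" "V1 \<inter> V2 \<subseteq> \<beta>1 a" and b: "b \<in> N2" "V1 \<inter> V2 \<subseteq> \<beta>2 b"
    and E: "\<And>u v. (u, v) \<in> E \<Longrightarrow> u \<in> V1 \<union> V2 \<Longrightarrow> v \<in> V1 \<union> V2 \<Longrightarrow>
      u \<in> V1 \<and> v \<in> V1 \<or> u \<in> V2 \<and> v \<in> V2"
  shows "tdec (V1 \<union> V2) E (N1 \<union> N2) (F1 \<union> F2 \<union> {(a, b), (b, a)})
    (\<lambda>t. if t \<in> N1 then \<beta>1 t else \<beta>2 t)" (is "tdec _ _ _ ?F ?\<beta>")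
  unfolding tdec_def
proof (intro conjI ballI impI)
  note 1 = tdecD[OF td1] and 2 = tdecD[OF td2]
  have b2: "?\<beta> t = \<beta>2 t" if "t \<in> N2" for t using that disj by auto
  show "ctree (N1 \<union> N2) ?F" by (rule ctree_join) fact+
  show "?\<beta> t \<subseteq> V1 \<union> V2" if "t \<in> N1 \<union> N2" for t
    using that 1(2) 2(2) by auto
  show "\<exists>t\<in>N1 \<union> N2. u \<in> ?\<beta> t \<and> v \<in> ?\<beta> t"
    if uv: "u \<in> V1 \<union> V2" "v \<in> V1 \<union> V2" "(u, v) \<in> E" for u v
    using E[OF uv(3,1,2)]
  proof
    assume "u \<in> V1 \<and> v \<in> V1"
    then obtain t where "t \<in> N1" "u \<in> \<beta>1 t" "v \<in> \<beta>1 t" using 1(5) uv(3) by blast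
    then show ?thesis by (intro bexI[of _ t]) auto
  next
    assume "u \<in> V2 \<and> v \<in> V2"
    then obtain t where "t \<in> N2" "u \<in> \<beta>2 t" "v \<in> \<beta>2 t" using 2(5) uv(3) by blast
    then show ?thesis by (intro bexI[of _ t]) (simp_all add: b2)
  qed
  fix v assume v: "v \<in> V1 \<union> V2"
  have split: "{t \<in> N1 \<union> N2. v \<in> ?\<beta> t} = {t \<in> N1. v \<in> \<beta>1 t} \<union> {t \<in> N2. v \<in> \<beta>2 t}"
    using disj by auto
  show "{t \<in> N1 \<union> N2. v \<in> ?\<beta> t} \<noteq> {}"
    unfolding split using v 1(3) 2(3) by blast
  consider "v \<in> V1" "v \<notin> V2" | "v \<in> V2" "v \<notin> V1" | "v \<in> V1" "v \<in> V2" using v by blast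
  then show "conn ?F {t \<in> N1 \<union> N2. v \<in> ?\<beta> t}"
  proof cases
    case 1
    then have e: "{t \<in> N2. v \<in> \<beta>2 t} = {}" using 2(2) by blast
    show ?thesis unfolding split e Un_empty_right
      by (rule conn_mono[OF tdecD(4)[OF td1 1(1)]]) blast
  next
    case 2
    then have e: "{t \<in> N1. v \<in> \<beta>1 t} = {}" using 1(2) by blast
    show ?thesis unfolding split e Un_empty_left
      by (rule conn_mono[OF tdecD(4)[OF td2 2(1)]]) blast
  next
    case 3
    then show ?thesis unfolding split
      using a b by (intro ctree_join(2)[OF 1(1) 2(1) disj a(1) b(1)] 1(4) 2(4)) auto
  qed
qed

lemma conn_map:
  assumes "conn F A"
  shows "conn (map_prod f f ` F) (f ` A)"
  unfolding conn_def
proof (intro allI impI)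
  fix U assume U: "U \<subseteq> f ` A" "U \<noteq> {}" "U \<noteq> f ` A"
  then obtain x y where "x \<in> A" "f x \<in> U" "y \<in> A" "f y \<notin> U" by blast
  then obtain p q where "p \<in> A" "f p \<in> U" "q \<in> A" "f q \<notin> U" "(p, q) \<in> F"
    using connD[OF assms, of x "f -` U" y] by auto
  then show "\<exists>x\<in>U. \<exists>y\<in>f ` A - U. (x, y) \<in> map_prod f f ` F"
    by (intro bexI[of _ "f p"] bexI[of _ "f q"]) auto
qed

lemma tdec_rename:
  assumes td: "tdec V E N F \<beta>" and f: "inj f"
  shows "tdec V E (f ` N) (map_prod f f ` F) (\<beta> \<circ> inv f)"
proof -
  have ex: "\<exists>S. a \<in> S \<and> b \<notin> S \<and>
      (\<forall>x y. (x, y) \<in> map_prod f f ` F \<longrightarrow> x \<in> S \<longrightarrow> y \<notin> S \<longrightarrow> x = a \<and> y = b)"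
    if ab: "(a, b) \<in> map_prod f f ` F" for a b
  proof -
    obtain p q where pq: "(p, q) \<in> F" "a = f p" "b = f q" using ab by auto
    obtain S where S: "p \<in> S" "q \<notin> S"
      and cut: "\<And>x y. (x, y) \<in> F \<Longrightarrow> x \<in> S \<Longrightarrow> y \<notin> S \<Longrightarrow> x = p \<and> y = q"
      using ctree_cut[OF tdecD(1)[OF td] pq(1)] by metis
    have "x = a \<and> y = b" if fxy: "(x, y) \<in> map_prod f f ` F" "x \<in> f ` S" "y \<notin> f ` S" for x y
    proof -
      obtain x' y' where xy: "(x', y') \<in> F" "x = f x'" "y = f y'" using fxy(1) by auto
      then have "x' \<in> S" "y' \<notin> S" using fxy(2,3) f by (auto simp: inj_def)
      then show ?thesis using cut[OF xy(1)] xy pq by simp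
    qed
    moreover have "a \<in> f ` S" "b \<notin> f ` S" using pq S f by (auto simp: inj_def)
    ultimately show ?thesis by blast
  qed
  note T = ctreeD[OF tdecD(1)[OF td]]
  have "ctree (f ` N) (map_prod f f ` F)"
    unfolding ctree_def
  proof (intro conjI)
    show "sym (map_prod f f ` F)" using T(4) by (auto simp: sym_def)
    show "conn (map_prod f f ` F) (f ` N)" using T(5) by (rule conn_map)
  qed (use T ex in auto)
  moreover have "{t \<in> f ` N. v \<in> (\<beta> \<circ> inv f) t} = f ` {t \<in> N. v \<in> \<beta> t}" for v
    using f by auto
  ultimately show ?thesis
    using td f unfolding tdec_def by (auto simp: conn_map)
qed

text \<open>\<open>\<D>\<close> is the set of bags; since this forgets the tree, decompositions can be glued without
  renaming nodes.\<close>

definition decomposable :: "'a set \<Rightarrow> 'a rel \<Rightarrow> 'a set set \<Rightarrow> bool" where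
  "decomposable V E \<D> \<longleftrightarrow> (\<exists>(N :: nat set) F \<beta>. tdec V E N F \<beta> \<and> \<beta> ` N = \<D>)"

lemma decomposable_single: "decomposable V E {V}"
proof -
  have "{t \<in> {0::nat}. v \<in> V} = {0}" if "v \<in> V" for v using that by auto
  then have "tdec V E {0 :: nat} {} (\<lambda>_. V)"
    by (auto simp: tdec_def ctree_singleton)
  then show ?thesis unfolding decomposable_def by blast
qed

lemma decomposable_glue:
  assumes 1: "decomposable V1 E \<D>1" "Z1 \<in> \<D>1" "V1 \<inter> V2 \<subseteq> Z1"
    and 2: "decomposable V2 E \<D>2" "Z2 \<in> \<D>2" "V1 \<inter> V2 \<subseteq> Z2"
    and E: "\<And>u v. (u, v) \<in> E \<Longrightarrow> u \<in> V1 \<union> V2 \<Longrightarrow> v \<in> V1 \<union> V2 \<Longrightarrow>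
      u \<in> V1 \<and> v \<in> V1 \<or> u \<in> V2 \<and> v \<in> V2"
  shows "decomposable (V1 \<union> V2) E (\<D>1 \<union> \<D>2)"
proof -
  obtain N1 :: "nat set" and F1 \<beta>1 where td1: "tdec V1 E N1 F1 \<beta>1" and D1: "\<beta>1 ` N1 = \<D>1"
    using 1 unfolding decomposable_def by blast
  obtain N2 :: "nat set" and F2 \<beta>2 where td2: "tdec V2 E N2 F2 \<beta>2" and D2: "\<beta>2 ` N2 = \<D>2"
    using 2 unfolding decomposable_def by blast
  \<comment> \<open>Even and odd numbers make the node sets disjoint within the same type.\<close>
  define f g where "f t = 2 * t" and "g t = 2 * t + 1" for t :: nat
  have inj: "inj f" "inj g" by (auto simp: f_def g_def inj_def)
  have disj: "f ` N1 \<inter> g ` N2 = {}" by (auto simp: f_def g_def) presburger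
  obtain a b where ab: "a \<in> N1" "\<beta>1 a = Z1" "b \<in> N2" "\<beta>2 b = Z2" using 1 2 D1 D2 by blast
  let ?\<beta> = "\<lambda>t. if t \<in> f ` N1 then (\<beta>1 \<circ> inv f) t else (\<beta>2 \<circ> inv g) t"
  have "\<exists>F. tdec (V1 \<union> V2) E (f ` N1 \<union> g ` N2) F ?\<beta>"
    by (rule exI, rule tdec_join[OF tdec_rename[OF td1 inj(1)] tdec_rename[OF td2 inj(2)] disj,
          of "f a" "g b"]) (use ab 1 2 E inj in auto)
  moreover have "?\<beta> ` (f ` N1 \<union> g ` N2) = \<D>1 \<union> \<D>2"
  proof -
    have "?\<beta> ` (f ` N1 \<union> g ` N2) = ?\<beta> ` f ` N1 \<union> ?\<beta> ` g ` N2" by (rule image_Un)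
    also have "?\<beta> ` f ` N1 = \<D>1"
      using inj by (simp add: image_image D1)
    also have "?\<beta> ` g ` N2 = (\<lambda>t. \<beta>2 (inv g t)) ` g ` N2"
      by (rule image_cong) (use disj in auto)
    also have "\<dots> = \<D>2" using inj by (simp add: image_image D2)
    finally show ?thesis .
  qed
  ultimately show ?thesis unfolding decomposable_def by blast
qed

section \<open>Bramble duality\<close>

definition bramble :: "'a set \<Rightarrow> 'a rel \<Rightarrow> 'a set set \<Rightarrow> bool" where
  "bramble V E \<B> \<longleftrightarrow> (\<forall>B\<in>\<B>. B \<subseteq> V \<and> B \<noteq> {} \<and> conn E B) \<and>
     (\<forall>A\<in>\<B>. \<forall>B\<in>\<B>. A \<inter> B \<noteq> {} \<or> (\<exists>x\<in>A. \<exists>y\<in>B. (x, y) \<in> E))"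

definition covers :: "'a set \<Rightarrow> 'a set set \<Rightarrow> bool" where
  "covers X \<B> \<longleftrightarrow> (\<forall>B\<in>\<B>. X \<inter> B \<noteq> {})"

text \<open>The induction hypothesis of bramble duality: every bag with more than \<open>k\<close> elements misses a
  member of \<open>\<B>\<close>. For \<open>\<B> = {}\<close> no bag can have more than \<open>k\<close> elements.\<close>

definition admissible :: "nat \<Rightarrow> 'a set set \<Rightarrow> 'a set set \<Rightarrow> bool" where
  "admissible k \<B> \<D> \<longleftrightarrow> (\<forall>D\<in>\<D>. k < card D \<longrightarrow> \<not> covers D \<B>)"

text \<open>In a tree this is the set of nodes on the path from \<open>s\<close> to \<open>t\<close>.\<close>

definition segment :: "'t set \<Rightarrow> 't rel \<Rightarrow> 't \<Rightarrow> 't \<Rightarrow> 't set" where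
  "segment N F s t = \<Inter>{A. A \<subseteq> N \<and> conn F A \<and> s \<in> A \<and> t \<in> A}"

lemma segment_subset: "A \<subseteq> N \<Longrightarrow> conn F A \<Longrightarrow> s \<in> A \<Longrightarrow> t \<in> A \<Longrightarrow> segment N F s t \<subseteq> A"
  unfolding segment_def by blast

lemma segment_ends: "s \<in> segment N F s t" "t \<in> segment N F s t"
  by (auto simp: segment_def)

lemma conn_segment:
  assumes T: "ctree N F" and st: "s \<in> N" "t \<in> N"
  shows "conn F (segment N F s t)"
proof -
  have Int: "conn F (\<Inter>\<A>)" if "finite \<A>" "\<A> \<noteq> {}" "\<And>A. A \<in> \<A> \<Longrightarrow> conn F A" for \<A>
    using that by (induction \<A> rule: finite_ne_induct) (auto intro: ctree_Int_conn[OF T])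
  have "finite {A. A \<subseteq> N \<and> conn F A \<and> s \<in> A \<and> t \<in> A}"
    using ctreeD(1)[OF T] by (auto intro: finite_subset[of _ "Pow N"])
  moreover have "N \<in> {A. A \<subseteq> N \<and> conn F A \<and> s \<in> A \<and> t \<in> A}"
    using st ctreeD(5)[OF T] by simp
  ultimately show ?thesis unfolding segment_def by (intro Int) blast+
qed

text \<open>Here \<open>C\<close> is a union of components of \<open>V - X\<close>. Bags keep what
  lies in \<open>X \<union> C\<close>, and each \<open>x\<close> of \<open>X\<close> is added along
  the path from some node whose bag contains it to \<open>s\<close>. The bag of \<open>s\<close>
  thus becomes \<open>X\<close>, where the pieces for different components can be glued.\<close>

lemma component_decomposition:
  assumes finV: "finite V" and E: "sym E" and \<B>: "bramble V E \<B>"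
    and X: "X \<subseteq> V" "covers X \<B>" "card X \<le> k"
    and minimal: "\<And>Y. Y \<subseteq> V \<Longrightarrow> covers Y \<B> \<Longrightarrow> card X \<le> card Y"
    and C: "C \<subseteq> V - X" and closed: "\<And>x y. x \<in> C \<Longrightarrow> y \<in> V - X \<Longrightarrow> (x, y) \<in> E \<Longrightarrow> y \<in> C"
    and td: "tdec V E N F \<beta>"
    and adm: "admissible k (insert C \<B>) (\<beta> ` N)"
    and s: "s \<in> N" "k < card (\<beta> s)" "covers (\<beta> s) \<B>"
  shows "\<exists>W. tdec (X \<union> C) E N F W \<and> W s = X \<and> admissible k \<B> (W ` N)"
proof -
  note T = tdecD(1)[OF td]
  \<comment> \<open>The bag of \<open>s\<close> is too large to cover \<open>insert C \<B>\<close>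
    but covers \<open>\<B>\<close>, so it must miss \<open>C\<close>.\<close>
  have sC: "\<beta> s \<inter> C = {}"
    using adm s by (auto simp: admissible_def covers_def)
  obtain \<tau> where \<tau>: "\<tau> x \<in> N" "x \<in> \<beta> (\<tau> x)" if "x \<in> V" for x
    using tdecD(3)[OF td] by metis
  define Z where "Z t = {x \<in> X. t \<in> segment N F (\<tau> x) s}" for t
  define W where "W t = \<beta> t \<inter> (X \<union> C) \<union> Z t" for t
  have ZX: "Z t \<subseteq> X" for t by (auto simp: Z_def)
  have segmentN: "segment N F (\<tau> x) s \<subseteq> N" if "x \<in> X" for x
    using \<tau> X s that ctreeD(5)[OF T] by (intro segment_subset) auto
  have "tdec (X \<union> C) E N F W"
    unfolding tdec_def
  proof (intro conjI ballI impI)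
    show "W t \<subseteq> X \<union> C" for t using ZX by (auto simp: W_def)
  next
    fix v assume v: "v \<in> X \<union> C"
    then have vV: "v \<in> V" using X C by blast
    then show "{t \<in> N. v \<in> W t} \<noteq> {}" using tdecD(3)[OF td] v by (auto simp: W_def)
    show "conn F {t \<in> N. v \<in> W t}"
    proof (cases "v \<in> X")
      case True
      then have "{t \<in> N. v \<in> W t} = {t \<in> N. v \<in> \<beta> t} \<union> segment N F (\<tau> v) s"
        using segmentN[OF True] by (auto simp: W_def Z_def)
      moreover have "\<tau> v \<in> {t \<in> N. v \<in> \<beta> t} \<inter> segment N F (\<tau> v) s"
        using \<tau>[OF vV] segment_ends by auto
      ultimately show ?thesis
        using conn_Un[OF ctreeD(4)[OF T] tdecD(4)[OF td vV] conn_segment[OF T \<tau>(1)[OF vV] s(1)]] by auto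
    next
      case False
      then have "{t \<in> N. v \<in> W t} = {t \<in> N. v \<in> \<beta> t}"
        using v by (auto simp: W_def Z_def)
      then show ?thesis using tdecD(4)[OF td vV] by simp
    qed
  next
    fix u v assume uv: "u \<in> X \<union> C" "v \<in> X \<union> C" "(u, v) \<in> E"
    then obtain t where "t \<in> N" "u \<in> \<beta> t" "v \<in> \<beta> t"
      using tdecD(5)[OF td, of u v] X C by blast
    then show "\<exists>t\<in>N. u \<in> W t \<and> v \<in> W t" using uv by (auto simp: W_def)
  qed (fact T)
  moreover have "W s = X"
    using sC segment_ends by (auto simp: W_def Z_def)
  moreover have "\<not> covers (W t) \<B>" if t: "t \<in> N" "k < card (W t)" for t
  proof
    assume cov: "covers (W t) \<B>"
    define Z' where "Z' = Z t - \<beta> t"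
    \<comment> \<open>The trace of \<open>B\<close> is a subtree containing \<open>\<tau> x\<close>
      and \<open>s\<close>, hence also the path between them, on which \<open>t\<close>
      lies.\<close>
    have meet: "B \<inter> \<beta> t \<noteq> {}"
      if "x \<in> Z'" "x \<in> B" "B \<subseteq> V" "conn E B" "B \<inter> \<beta> s \<noteq> {}" for x B
    proof -
      have x: "x \<in> X" "t \<in> segment N F (\<tau> x) s" "x \<in> V" using that X by (auto simp: Z'_def Z_def)
      have "segment N F (\<tau> x) s \<subseteq> {t \<in> N. \<beta> t \<inter> B \<noteq> {}}"
        by (rule segment_subset[OF _ tdec_trace_conn[OF td that(3,4)]]) (use \<tau> x s that in auto)
      then show ?thesis using x by blast
    qed
    \<comment> \<open>\<open>U\<close> covers \<open>\<B>\<close>, so minimality of \<open>X\<close> gives \<open>card X \<le> card U\<close>, which yields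
      \<open>card (W t) \<le> card (\<beta> t)\<close>. This replaces the disjoint paths that Menger's theorem
      provides in the textbook proof.\<close>
    define U where "U = (\<beta> t - (X \<union> C)) \<union> (X - Z')"
    have "covers U \<B>"
      unfolding covers_def
    proof (intro ballI notI)
      fix B assume B: "B \<in> \<B>" and no: "U \<inter> B = {}"
      then have BV: "B \<subseteq> V" "conn E B" using \<B> by (auto simp: bramble_def)
      have BX: "B \<inter> X \<subseteq> Z'" using no by (auto simp: U_def)
      obtain y where y: "y \<in> B" "y \<in> \<beta> s" using s(3) B by (auto simp: covers_def)
      have yX: "y \<notin> X"
      proof
        assume "y \<in> X"
        then have "y \<in> Z'" using y BX by blast
        \<comment> \<open>The singleton \<open>{y}\<close> is connected and meets the bag of
          \<open>s\<close>, so \<open>meet\<close> puts \<open>y\<close> into the bag of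
          \<open>t\<close>.\<close>
        then have "{y} \<inter> \<beta> t \<noteq> {}" using meet[of y "{y}"] y BV by auto
        then show False using \<open>y \<in> Z'\<close> by (auto simp: Z'_def)
      qed
      \<comment> \<open>\<open>D\<close> starts outside \<open>C\<close> and avoids
        \<open>X\<close>, so it never enters \<open>C\<close>. An edge within \<open>B\<close>
        leaves it towards some \<open>x\<close> in \<open>Z'\<close>. As \<open>x\<close> is not in
        the bag of \<open>t\<close>, applying \<open>meet\<close> to \<open>D\<close> with this edge
        finds a vertex of \<open>D\<close> in that bag, and this vertex lies in
        \<open>U\<close>.\<close>
      define D where "D = component E (B - X) y"
      have D: "D \<subseteq> B - X" "y \<in> D" "conn E D"
        unfolding D_def using y yX by (auto intro!: component_subset conn_component E)
      have DC: "D \<inter> C = {}"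
      proof (rule ccontr)
        assume "D \<inter> C \<noteq> {}"
        then obtain z where "z \<in> D" "z \<in> C" by blast
        then obtain p q where "p \<in> D" "p \<in> C" "q \<in> D" "q \<notin> C" "(p, q) \<in> E"
          by (rule connD[OF D(3) _ _ D(2)]) (use y sC in auto)
        then show False using closed[of p q] D BV by blast
      qed
      obtain x' where "x' \<in> X" "x' \<in> B" using X(2) B by (auto simp: covers_def)
      then have "x' \<notin> D" using D by blast
      obtain p x where px: "p \<in> B" "p \<in> D" "x \<in> B" "x \<notin> D" "(p, x) \<in> E"
        by (rule connD[OF BV(2) y(1) D(2) \<open>x' \<in> B\<close> \<open>x' \<notin> D\<close>])
      have xX: "x \<in> X"
        using component_step[of p E "B - X" y x] px D(1) unfolding D_def by blast
      have xZ: "x \<in> Z'" using xX px BX by blast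
      have "conn E {p, x}" using px E by (intro conn_pair) (auto dest: symD)
      then have "conn E (D \<union> {p, x})" using px by (intro conn_Un E D) auto
      then have "(D \<union> {p, x}) \<inter> \<beta> t \<noteq> {}"
        by (rule meet[OF xZ, rotated 2]) (use px D y BV in auto)
      then obtain z where "z \<in> D" "z \<in> \<beta> t"
        using px xZ by (auto simp: Z'_def)
      then have "z \<in> U \<inter> B" using D DC by (auto simp: U_def)
      then show False using no by blast
    qed
    moreover have "U \<subseteq> V" using X tdecD(2)[OF td t(1)] by (auto simp: U_def)
    ultimately have "card X \<le> card U" by (rule minimal[rotated])
    have fin: "finite X" "finite (\<beta> t)" "finite Z'"
      using finV X tdecD(2)[OF td t(1)] ZX[of t]
      by (auto simp: Z'_def intro: finite_subset)
    have Z'X: "Z' \<subseteq> X" using ZX by (auto simp: Z'_def)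
    have "card U = card (\<beta> t - (X \<union> C)) + card (X - Z')"
      unfolding U_def using fin by (intro card_Un_disjoint) auto
    also have "card (X - Z') = card X - card Z'" using fin Z'X by (intro card_Diff_subset)
    finally have "card Z' \<le> card (\<beta> t - (X \<union> C))"
      using \<open>card X \<le> card U\<close> card_mono[OF fin(1) Z'X] by linarith
    moreover have "card (W t) = card (\<beta> t \<inter> (X \<union> C)) + card Z'"
    proof -
      have "W t = (\<beta> t \<inter> (X \<union> C)) \<union> Z'" using ZX[of t] by (auto simp: W_def Z'_def)
      then show ?thesis using fin by (simp add: card_Un_disjoint Z'_def disjoint_iff)
    qed
    moreover have "card (\<beta> t) = card (\<beta> t \<inter> (X \<union> C)) + card (\<beta> t - (X \<union> C))"
      using fin(2) by (rule card_Int_Diff)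
    ultimately have "k < card (\<beta> t)" using t(2) by linarith
    then obtain B where B: "B \<in> insert C \<B>" "\<beta> t \<inter> B = {}"
      using adm t(1) by (auto simp: admissible_def covers_def)
    \<comment> \<open>\<open>W t\<close> is too large to fit into \<open>X\<close>, so
      \<open>\<beta> t\<close> meets \<open>C\<close>; the missed set \<open>B\<close> is then a
      member of \<open>\<B>\<close>, and \<open>meet\<close> applies to it.\<close>
    have "\<not> W t \<subseteq> X"
      using card_mono[OF fin(1), of "W t"] t(2) X(3) by auto
    then have "\<beta> t \<inter> C \<noteq> {}" using ZX[of t] by (auto simp: W_def)
    then have "B \<in> \<B>" using B by auto
    then obtain x where "x \<in> W t" "x \<in> B" using cov by (auto simp: covers_def)
    then have "x \<in> Z'" using B(2) by (auto simp: W_def Z'_def)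
    moreover have "B \<inter> \<beta> s \<noteq> {}" using s(3) \<open>B \<in> \<B>\<close> by (auto simp: covers_def)
    ultimately show False
      using meet[of x B] \<open>x \<in> B\<close> \<B> \<open>B \<in> \<B>\<close> B(2) by (auto simp: bramble_def)
  qed
  ultimately show ?thesis unfolding admissible_def by blast
qed

text \<open>The induction runs through ever larger brambles. For a cover \<open>X\<close> of least
  size, each component of \<open>V - X\<close> yields a decomposition with \<open>X\<close> as a
  bag, and these are glued along \<open>X\<close>.\<close>

lemma admissible_decomposition:
  assumes finV: "finite V" and E: "sym E"
    and small: "\<And>\<B>. bramble V E \<B> \<Longrightarrow> \<exists>X\<subseteq>V. covers X \<B> \<and> card X \<le> k"
    and "bramble V E \<B>"
  shows "\<exists>\<D>. decomposable V E \<D> \<and> admissible k \<B> \<D>"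
  using \<open>bramble V E \<B>\<close>
proof (induction "card (Pow V - \<B>)" arbitrary: \<B> rule: less_induct)
  case less
  note \<B> = \<open>bramble V E \<B>\<close>
  obtain X where X: "X \<subseteq> V" "covers X \<B>"
    and minimal: "\<And>Y. Y \<subseteq> V \<Longrightarrow> covers Y \<B> \<Longrightarrow> card X \<le> card Y"
  proof -
    obtain X0 where "X0 \<subseteq> V \<and> covers X0 \<B>" using small[OF \<B>] by blast
    from ex_has_least_nat[of "\<lambda>X. X \<subseteq> V \<and> covers X \<B>", OF this, of card] that
    show ?thesis by blast
  qed
  obtain X1 where "X1 \<subseteq> V" "covers X1 \<B>" "card X1 \<le> k" using small[OF \<B>] by blast
  then have Xk: "card X \<le> k" using minimal[of X1] by linarith
  show ?case
  proof (rule ccontr)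
    assume contra: "\<not> ?case"
    have comp: "\<exists>\<D>. decomposable (X \<union> C) E \<D> \<and> X \<in> \<D> \<and> admissible k \<B> \<D>"
      if C: "C \<subseteq> V - X" "C \<noteq> {}" "conn E C"
        and closed: "\<And>x y. x \<in> C \<Longrightarrow> y \<in> V - X \<Longrightarrow> (x, y) \<in> E \<Longrightarrow> y \<in> C" for C
    proof (cases "bramble V E (insert C \<B>)")
      case True
      \<comment> \<open>Every member of \<open>\<B>\<close> meets \<open>X\<close> while
        \<open>C\<close> avoids it, so the bramble really grows.\<close>
      have "C \<notin> \<B>" using X(2) C by (auto simp: covers_def)
      then have "Pow V - insert C \<B> \<subset> Pow V - \<B>" using C by blast
      then have "card (Pow V - insert C \<B>) < card (Pow V - \<B>)"
        using finV by (intro psubset_card_mono) auto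
      from less.hyps[OF this True] obtain \<D> where "decomposable V E \<D>" and adm: "admissible k (insert C \<B>) \<D>"
        by blast
      then obtain N :: "nat set" and F \<beta> where td: "tdec V E N F \<beta>" and \<D>: "\<D> = \<beta> ` N"
        unfolding decomposable_def by blast
      \<comment> \<open>Failure for \<open>\<B>\<close> singles out a large bag that covers
        \<open>\<B>\<close>; this is the one to be turned into \<open>X\<close>.\<close>
      have "\<not> admissible k \<B> (\<beta> ` N)"
        using contra td unfolding decomposable_def by blast
      then obtain s where s: "s \<in> N" "k < card (\<beta> s)" "covers (\<beta> s) \<B>"
        unfolding admissible_def by blast
      have "\<exists>W. tdec (X \<union> C) E N F W \<and> W s = X \<and> admissible k \<B> (W ` N)"
        by (rule component_decomposition[OF finV E \<B> X Xk _ C(1) _ td adm[unfolded \<D>] s])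
          (use minimal closed in blast)+
      then show ?thesis using s(1) unfolding decomposable_def by blast
    next
      case False
      have symE: "(x, y) \<in> E \<longleftrightarrow> (y, x) \<in> E" for x y using E by (blast dest: symD)
      obtain B where B: "B \<in> \<B>" "B \<inter> C = {}" "\<And>x y. x \<in> B \<Longrightarrow> y \<in> C \<Longrightarrow> (x, y) \<notin> E"
      proof (rule ccontr)
        assume "\<not> thesis"
        with that have *: "B \<inter> C \<noteq> {} \<or> (\<exists>x\<in>B. \<exists>y\<in>C. (x, y) \<in> E)" if "B \<in> \<B>" for B
          using that by blast
        then have "C \<inter> B \<noteq> {} \<or> (\<exists>x\<in>C. \<exists>y\<in>B. (x, y) \<in> E)" if "B \<in> \<B>" for B
          using that symE by blast
        with * have "bramble V E (insert C \<B>)"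
          using \<B> C unfolding bramble_def by auto
        then show False using False by simp
      qed
      \<comment> \<open>\<open>Y\<close> is \<open>C\<close> with its neighbours in
        \<open>X\<close>. Since \<open>B\<close> neither meets \<open>C\<close> nor is adjacent to
        it, \<open>Y\<close> misses \<open>B\<close> and may be a bag of any size.\<close>
      define Y where "Y = C \<union> {x \<in> X. \<exists>y\<in>C. (x, y) \<in> E}"
      have "decomposable (X \<union> Y) E ({X} \<union> {Y})"
      proof (rule decomposable_glue[OF decomposable_single _ _ decomposable_single])
        fix u v assume "(u, v) \<in> E" "u \<in> X \<union> Y" "v \<in> X \<union> Y"
        then show "u \<in> X \<and> v \<in> X \<or> u \<in> Y \<and> v \<in> Y"
          using symE by (auto simp: Y_def)
      qed auto
      moreover have "X \<union> Y = X \<union> C" by (auto simp: Y_def)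
      moreover have "Y \<inter> B = {}" using B symE by (auto simp: Y_def)
      then have "admissible k \<B> ({X} \<union> {Y})"
        using Xk B(1) by (auto simp: admissible_def covers_def)
      ultimately show ?thesis by auto
    qed
    \<comment> \<open>\<open>W\<close> ranges over unions of components of \<open>V - X\<close>, and
      one component is split off at a time. The case \<open>W = V - X\<close> contradicts the
      assumption.\<close>
    have "\<exists>\<D>. decomposable (X \<union> W) E \<D> \<and> X \<in> \<D> \<and> admissible k \<B> \<D>"
      if "W \<subseteq> V - X" and "\<And>x y. x \<in> W \<Longrightarrow> y \<in> V - X \<Longrightarrow> (x, y) \<in> E \<Longrightarrow> y \<in> W" for W
      using that
    proof (induction "card W" arbitrary: W rule: less_induct)
      case (less W)
      show ?case
      proof (cases "W = {}")
        case True
        have "admissible k \<B> {X}" using Xk by (auto simp: admissible_def)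
        then show ?thesis using True decomposable_single by auto
      next
        case False
        then obtain v where v: "v \<in> W" by blast
        define C where "C = component E W v"
        have C: "C \<subseteq> W" "v \<in> C" "conn E C"
          unfolding C_def using component_subset[OF v] conn_component[OF E] by auto
        have closed: "y \<in> C" if "x \<in> C" "y \<in> V - X" "(x, y) \<in> E" for x y
          using that less.prems(2)[of x y] C(1) component_step[of x E W v y] unfolding C_def by blast
        obtain \<D>1 where 1: "decomposable (X \<union> C) E \<D>1" "X \<in> \<D>1" "admissible k \<B> \<D>1"
          using comp[of C] C less.prems closed by blast
        have "finite W" using finV less.prems by (auto intro: finite_subset)
        then have "card (W - C) < card W" using C v by (intro psubset_card_mono) auto
        moreover have "y \<in> W - C" if "x \<in> W - C" "y \<in> V - X" "(x, y) \<in> E" for x y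
          using that less.prems closed[of y x] E by (auto dest: symD)
        ultimately obtain \<D>2 where 2: "decomposable (X \<union> (W - C)) E \<D>2" "X \<in> \<D>2" "admissible k \<B> \<D>2"
          using less.hyps[of "W - C"] less.prems(1) \<open>finite W\<close> by blast
        have "decomposable ((X \<union> C) \<union> (X \<union> (W - C))) E (\<D>1 \<union> \<D>2)"
        proof (rule decomposable_glue[OF 1(1,2) _ 2(1,2)])
          fix u v' assume uv: "(u, v') \<in> E" "u \<in> (X \<union> C) \<union> (X \<union> (W - C))" "v' \<in> (X \<union> C) \<union> (X \<union> (W - C))"
          have "v' \<in> C" if "u \<in> C" "v' \<in> W" using closed[of u v'] that uv less.prems(1) by blast
          moreover have "u \<in> C" if "v' \<in> C" "u \<in> W"
            using closed[of v' u] that symD[OF E uv(1)] less.prems(1) by blast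
          ultimately show "u \<in> X \<union> C \<and> v' \<in> X \<union> C \<or> u \<in> X \<union> (W - C) \<and> v' \<in> X \<union> (W - C)"
            using uv by blast
        qed (use C less.prems(1) in blast)+
        moreover have "(X \<union> C) \<union> (X \<union> (W - C)) = X \<union> W" using C by blast
        moreover have "admissible k \<B> (\<D>1 \<union> \<D>2)" using 1 2 by (auto simp: admissible_def)
        ultimately show ?thesis using 1 by auto
      qed
    qed
    from this[of "V - X"] contra X(1) show False
      by (auto simp: Un_absorb1)
  qed
qed

text \<open>The empty bramble is covered by every set, so a decomposition admissible for it has no
  bag with more than \<open>k\<close> elements.\<close>

theorem bramble_duality:
  assumes "finite V" "sym E"
    and "\<And>\<B>. bramble V E \<B> \<Longrightarrow> \<exists>X\<subseteq>V. covers X \<B> \<and> card X \<le> k"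
  shows "\<exists>(N :: nat set) F \<beta>. tdec V E N F \<beta> \<and> (\<forall>t\<in>N. card (\<beta> t) \<le> k)"
proof -
  have "bramble V E {}" by (simp add: bramble_def)
  then obtain \<D> where \<D>: "decomposable V E \<D>" "admissible k {} \<D>"
    using admissible_decomposition[OF assms] by blast
  obtain N :: "nat set" and F \<beta> where "tdec V E N F \<beta>" "\<beta> ` N = \<D>"
    using \<D>(1) unfolding decomposable_def by blast
  moreover from this \<D>(2) have "\<forall>t\<in>N. card (\<beta> t) \<le> k"
    by (auto simp: admissible_def covers_def not_less)
  ultimately show ?thesis by blast
qed

section \<open>Trees as graphs\<close>

lemma rtrancl_pcas_path:
  assumes "(u, v) \<in> F\<^sup>*"
  obtains p where "pcas u p v" "set p \<subseteq> F" "distinct (pawalk_verts u p)"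
proof -
  \<comment> \<open>With the whole type as vertex set any \<open>F\<close> gives a well-formed
    digraph, in which walks can be shortened to paths.\<close>
  let ?G = "\<lparr>pverts = UNIV, parcs = F\<rparr>"
  interpret W: pair_wf_digraph ?G by unfold_locales simp_all
  have "\<exists>p. W.awalk u p v"
    using assms
  proof (induction rule: converse_rtrancl_induct)
    case base
    show ?case by (intro exI[of _ "[]"]) (simp add: W.awalk_Nil_iff)
  next
    case (step y z)
    then obtain p where "W.awalk z p v" by blast
    with step(1) show ?case by (intro exI[of _ "(y, z) # p"]) (simp add: W.awalk_Cons_iff)
  qed
  then obtain p where "W.apath u p v" using W.apath_awalk_to_apath by blast
  then show ?thesis using that by (auto simp: W.apath_def W.awalk_def)
qed

lemma pcas_crossing:
  "pcas u p v \<Longrightarrow> u \<notin> S \<Longrightarrow> v \<in> S \<Longrightarrow> \<exists>x y. (x, y) \<in> set p \<and> x \<notin> S \<and> y \<in> S"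
  by (induction p arbitrary: u) (auto, metis)

lemma pcas_last_in_tl_verts:
  "pcas u p v \<Longrightarrow> p \<noteq> [] \<Longrightarrow> v \<in> set (tl (pawalk_verts u p))"
proof (induction p arbitrary: u)
  case (Cons e p)
  show ?case
  proof (cases p)
    case Nil
    then show ?thesis using Cons.prems by simp
  next
    case (Cons e' p')
    then show ?thesis using Cons.IH[of "snd e"] Cons.prems by auto
  qed
qed simp

lemma fst_in_pawalk_verts: "(x, y) \<in> set p \<Longrightarrow> x \<in> set (pawalk_verts u p)"
  by (induction p arbitrary: u) auto

lemma cycle_with_proj_iff:
  "pre_digraph.cycle (with_proj T) p \<longleftrightarrow>
     (\<exists>u\<in>pverts T. set p \<subseteq> parcs T \<and> pcas u p u \<and> distinct (tl (pawalk_verts u p)) \<and> p \<noteq> [])"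
  by (auto simp: pre_digraph.cycle_def pre_digraph.awalk_def cas_with_proj_eq awalk_verts_with_proj_eq)

lemma connected_induce_iff:
  assumes "sym (parcs T)" and "parcs T \<subseteq> pverts T \<times> pverts T"
  shows "connected (with_proj T \<restriction> A) \<longleftrightarrow> A \<noteq> {} \<and> conn (parcs T) A"
proof -
  let ?G = "with_proj T \<restriction> A"
  have ae: "arcs_ends ?G = parcs T \<inter> A \<times> A"
    by (auto simp: arcs_ends_conv)
  have s: "(arcs_ends ?G)\<^sup>s = parcs T \<inter> A \<times> A"
    using assms(1) by (auto simp: ae symcl_def sym_def)
  have v: "verts ?G = A" by simp
  have eq: "(u, w) \<in> rtrancl_on A (parcs T \<inter> A \<times> A) \<longleftrightarrow> (u, w) \<in> (parcs T \<inter> A \<times> A)\<^sup>*"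
    if "u \<in> A" for u w
  proof
    assume "(u, w) \<in> rtrancl_on A (parcs T \<inter> A \<times> A)"
    then show "(u, w) \<in> (parcs T \<inter> A \<times> A)\<^sup>*"
      by (induction rule: rtrancl_on_induct) (auto intro: rtrancl_into_rtrancl)
  next
    assume "(u, w) \<in> (parcs T \<inter> A \<times> A)\<^sup>*"
    then show "(u, w) \<in> rtrancl_on A (parcs T \<inter> A \<times> A)"
      by (induction rule: rtrancl_induct) (auto simp: that intro: rtrancl_on_into_rtrancl_on)
  qed
  have "connected ?G \<longleftrightarrow> A \<noteq> {} \<and> (\<forall>u\<in>A. \<forall>w\<in>A. (u, w) \<in> (parcs T \<inter> A \<times> A)\<^sup>*)"
    unfolding connected_conv s v using eq by simp
  also have "\<dots> \<longleftrightarrow> A \<noteq> {} \<and> conn (parcs T) A"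
  proof (intro conj_cong refl iffI ballI)
    assume "A \<noteq> {}" "\<forall>u\<in>A. \<forall>w\<in>A. (u, w) \<in> (parcs T \<inter> A \<times> A)\<^sup>*"
    then show "conn (parcs T) A" using conn_reach[OF assms(1)] by blast
  next
    fix u w assume c: "conn (parcs T) A" and uw: "u \<in> A" "w \<in> A"
    show "(u, w) \<in> (parcs T \<inter> A \<times> A)\<^sup>*"
    proof (rule ccontr)
      assume "\<not> ?thesis"
      then have "w \<notin> component (parcs T) A u" by (simp add: component_def)
      then obtain p q where "p \<in> A" "p \<in> component (parcs T) A u" "q \<in> A"
        "q \<notin> component (parcs T) A u" "(p, q) \<in> parcs T"
        by (rule connD[OF c uw(1) component_self uw(2)])
      then show False using component_step[of p "parcs T" A u q] by simp
    qed
  qed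
  finally show ?thesis .
qed

lemma connected_iff_conn:
  assumes "sym (parcs T)" and "parcs T \<subseteq> pverts T \<times> pverts T"
  shows "connected (with_proj T) \<longleftrightarrow> pverts T \<noteq> {} \<and> conn (parcs T) (pverts T)"
proof -
  have "arcs_ends (with_proj T \<restriction> pverts T) = arcs_ends (with_proj T)"
    using assms(2) by (auto simp: arcs_ends_conv)
  then have "connected (with_proj T) \<longleftrightarrow> connected (with_proj T \<restriction> pverts T)"
    by (simp add: connected_conv)
  then show ?thesis using connected_induce_iff[OF assms] by simp
qed

lemma pair_graphD:
  assumes "pair_graph G"
  shows "finite (pverts G)" "parcs G \<subseteq> pverts G \<times> pverts G" "sym (parcs G)"
    "\<And>x. (x, x) \<notin> parcs G"
proof -
  interpret G: pair_graph G by fact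
  show "finite (pverts G)" by simp
  show "parcs G \<subseteq> pverts G \<times> pverts G" using G.in_arcsD1 G.in_arcsD2 by auto
  show "sym (parcs G)" using G.pair_sym_arcs by (simp add: symmetric_def)
  show "(x, x) \<notin> parcs G" for x using G.pair_no_loops by fastforce
qed

text \<open>Let \<open>S\<close> be what \<open>a\<close> reaches without the edge
  \<open>ab\<close>: if it contained \<open>b\<close>, a path back would close a cycle of length at
  least three. Conversely, a cycle through the bridge \<open>ab\<close> can re-enter
  \<open>S\<close> only by \<open>ba\<close>, and distinctness of its vertices then leaves no
  further arcs.\<close>

lemma undirected_tree_iff_ctree: "undirected_tree T \<longleftrightarrow> ctree (pverts T) (parcs T)"
proof
  assume T: "undirected_tree T"
  then have "pair_graph T" by (simp add: undirected_tree_def)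
  note G = pair_graphD[OF this]
  have cut: "\<exists>S. a \<in> S \<and> b \<notin> S \<and>
      (\<forall>x y. (x, y) \<in> parcs T \<longrightarrow> x \<in> S \<longrightarrow> y \<notin> S \<longrightarrow> x = a \<and> y = b)"
    if ab: "(a, b) \<in> parcs T" for a b
  proof -
    define F where "F = parcs T - {(a, b), (b, a)}"
    define S where "S = {x. (a, x) \<in> F\<^sup>*}"
    have "b \<notin> S"
    proof
      assume "b \<in> S"
      moreover have "sym F" using G(3) by (auto simp: F_def sym_def)
      ultimately have "(b, a) \<in> F\<^sup>*" using sym_rtrancl[of F] by (auto simp: S_def dest: symD)
      then obtain p where p: "pcas b p a" "set p \<subseteq> F" "distinct (pawalk_verts b p)"
        by (rule rtrancl_pcas_path)
      \<comment> \<open>The absence of loops rules out the empty path and the removal of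
        \<open>ba\<close> a single arc, so \<open>p\<close> has at least two arcs.\<close>
      have "p \<noteq> []" using p(1) ab G(4) by auto
      moreover have "p \<noteq> [e]" for e using p(1,2) by (cases e) (auto simp: F_def)
      ultimately have "3 \<le> length ((a, b) # p)"
        by (cases p rule: remdups_adj.cases) auto
      moreover have "pre_digraph.cycle (with_proj T) ((a, b) # p)"
        unfolding cycle_with_proj_iff using p ab G(2) by (intro bexI[of _ a]) (auto simp: F_def)
      ultimately show False using T by (auto simp: undirected_tree_def)
    qed
    moreover have "x = a \<and> y = b" if "(x, y) \<in> parcs T" "x \<in> S" "y \<notin> S" for x y
    proof (rule ccontr)
      assume "\<not> ?thesis"
      moreover have "(x, y) \<notin> F" using that by (auto simp: S_def intro: rtrancl_into_rtrancl)
      ultimately have "x = b" using that(1) by (auto simp: F_def)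
      then show False using that(2) \<open>b \<notin> S\<close> by simp
    qed
    moreover have "a \<in> S" by (simp add: S_def)
    ultimately show ?thesis by blast
  qed
  have "conn (parcs T) (pverts T)" "pverts T \<noteq> {}"
    using T connected_iff_conn[OF G(3,2)] by (auto simp: undirected_tree_def)
  then show "ctree (pverts T) (parcs T)"
    unfolding ctree_def using G cut by blast
next
  assume T: "ctree (pverts T) (parcs T)"
  note F = ctreeD[OF T]
  have "pair_graph T"
  proof
    show "finite (pverts T)" by fact
    then show "finite (parcs T)" using F(3) by (meson finite_SigmaI finite_subset)
    show "fst e \<in> pverts T" "snd e \<in> pverts T" if "e \<in> parcs T" for e using that F(3) by auto
    show "fst e \<noteq> snd e" if e: "e \<in> parcs T" for e
    proof -
      obtain S where "fst e \<in> S" "snd e \<notin> S"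
        by (rule ctree_cut[OF T, of "fst e" "snd e"]) (use e in auto)
      then show ?thesis by auto
    qed
    show "symmetric (with_proj T)" using F(4) by (simp add: symmetric_def)
  qed
  moreover have "connected (with_proj T)"
    using connected_iff_conn[OF F(4,3)] F by simp
  moreover have "length p < 3" if cyc: "pre_digraph.cycle (with_proj T) p" for p
  proof -
    obtain a where p: "set p \<subseteq> parcs T" "pcas a p a" "distinct (tl (pawalk_verts a p))" "p \<noteq> []"
      using cyc by (auto simp: cycle_with_proj_iff)
    obtain b q where pq: "p = (a, b) # q" using p(2,4) by (cases p) auto
    have ab: "(a, b) \<in> parcs T" and q: "pcas b q a" "distinct (pawalk_verts b q)" "set q \<subseteq> parcs T"
      using p by (auto simp: pq)
    obtain S where S: "a \<in> S" "b \<notin> S"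
      and cut: "\<And>x y. (x, y) \<in> parcs T \<Longrightarrow> x \<in> S \<Longrightarrow> y \<notin> S \<Longrightarrow> x = a \<and> y = b"
      using ctree_cut[OF T ab] by metis
    obtain x y where xy: "(x, y) \<in> set q" "x \<notin> S" "y \<in> S"
      using pcas_crossing[OF q(1) S(2,1)] by blast
    then have "(y, x) \<in> parcs T" using q(3) F(4) by (blast dest: symD)
    with cut xy have ba: "(b, a) \<in> set q" by blast
    then obtain e r where qe: "q = e # r" by (cases q) auto
    have "fst e = b" using q(1) by (simp add: qe)
    moreover have "(b, a) \<notin> set r"
      using q(2) \<open>fst e = b\<close> fst_in_pawalk_verts[of b a r "snd e"] by (auto simp: qe)
    ultimately have "e = (b, a)" using ba by (auto simp: qe)
    then have r: "pcas a r a" "distinct (pawalk_verts a r)" using q by (simp_all add: qe)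
    have "r = []"
    proof (rule ccontr)
      assume "r \<noteq> []"
      then show False using pcas_last_in_tl_verts[OF r(1)] r
        by (cases r) auto
    qed
    then show ?thesis by (simp add: pq qe)
  qed
  ultimately show "undirected_tree T"
    unfolding undirected_tree_def by (meson not_less)
qed

lemma tree_decomposition_iff_tdec:
  assumes "pair_graph G"
  shows "tree_decomposition G T \<beta> \<longleftrightarrow> tdec (pverts G) (parcs G) (pverts T) (parcs T) \<beta>"
proof (cases "ctree (pverts T) (parcs T)")
  case True
  note T = ctreeD[OF True]
  show ?thesis
    unfolding tree_decomposition_def tdec_def undirected_tree_iff_ctree
      connected_induce_iff[OF T(4,3)]
    using pair_graphD(2)[OF assms] by fastforce
next
  case False
  then show ?thesis by (simp add: tree_decomposition_def tdec_def undirected_tree_iff_ctree)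
qed

section \<open>Cartesian products\<close>

text \<open>The tree stays fixed and only the bags change, so bag sizes can be compared node by
  node.\<close>

lemma product_tdec_project:
  fixes G :: "'a pair_pre_digraph" and H :: "'b pair_pre_digraph"
  assumes G: "pair_graph G" and H: "pair_graph H"
    and \<B>: "bramble (pverts H) (parcs H) \<B>"
    and order: "\<And>X. X \<subseteq> pverts H \<Longrightarrow> covers X \<B> \<Longrightarrow> l \<le> card X"
    and td: "tdec (pverts (G \<box> H)) (parcs (G \<box> H)) N F \<beta>"
  shows "\<exists>\<gamma>. tdec (pverts G) (parcs G) N F \<gamma> \<and> (\<forall>t\<in>N. card (\<gamma> t) * l \<le> 2 * card (\<beta> t))"
proof -
  note T = tdecD(1)[OF td]
  note N = ctreeD[OF T]
  have finG: "finite (pverts G)" and finH: "finite (pverts H)" and symG: "sym (parcs G)"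
    and vertsG: "parcs G \<subseteq> pverts G \<times> pverts G"
    using pair_graphD G H by blast+
  have pv: "pverts (G \<box> H) = pverts G \<times> pverts H" by (simp add: cartesian_product_def)
  define w where "w g t = {h. (g, h) \<in> \<beta> t}" for g t
  have wH: "w g t \<subseteq> pverts H" if "t \<in> N" for g t
    using tdecD(2)[OF td that] by (auto simp: w_def pv)
  have finw: "finite (w g t)" if "t \<in> N" for g t
    using wH[OF that] finH finite_subset by blast
  define trace where "trace g B = {t \<in> N. \<beta> t \<inter> ({g} \<times> B) \<noteq> {}}" for g B
  have copy: "{g} \<times> B \<subseteq> pverts (G \<box> H)" "conn (parcs (G \<box> H)) ({g} \<times> B)"
    if "g \<in> pverts G" "B \<in> \<B>" for g B
  proof -
    have B: "B \<subseteq> pverts H" "conn (parcs H) B" using \<B> that by (auto simp: bramble_def)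
    show "{g} \<times> B \<subseteq> pverts (G \<box> H)" using B that by (auto simp: pv)
    have "conn (map_prod (Pair g) (Pair g) ` parcs H) (Pair g ` B)" using B(2) by (rule conn_map)
    moreover have "map_prod (Pair g) (Pair g) ` parcs H \<subseteq> parcs (G \<box> H)"
      using that by (auto simp: cartesian_product_def)
    moreover have "Pair g ` B = {g} \<times> B" by auto
    ultimately show "conn (parcs (G \<box> H)) ({g} \<times> B)" using conn_mono by metis
  qed
  have trace_conn: "conn F (trace g B)" if "g \<in> pverts G" "B \<in> \<B>" for g B
    unfolding trace_def using tdec_trace_conn[OF td copy[OF that]] .
  have trace_meet: "trace g A \<inter> trace g B \<noteq> {}" if g: "g \<in> pverts G" and AB: "A \<in> \<B>" "B \<in> \<B>" for g A B
  proof -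
    have sub: "A \<subseteq> pverts H" "B \<subseteq> pverts H" using \<B> AB by (auto simp: bramble_def)
    have "A \<inter> B \<noteq> {} \<or> (\<exists>x\<in>A. \<exists>y\<in>B. (x, y) \<in> parcs H)"
      using \<B> AB by (simp add: bramble_def)
    then obtain x y where xy: "x \<in> A" "y \<in> B" "x = y \<or> (x, y) \<in> parcs H" by blast
    have "\<exists>t\<in>N. (g, x) \<in> \<beta> t \<and> (g, y) \<in> \<beta> t"
    proof (cases "x = y")
      case True
      then show ?thesis using tdecD(3)[OF td, of "(g, x)"] xy sub g by (auto simp: pv)
    next
      case False
      then have "((g, x), (g, y)) \<in> parcs (G \<box> H)"
        using xy g by (auto simp: cartesian_product_def)
      then show ?thesis using tdecD(5)[OF td, of "(g, x)" "(g, y)"] xy sub g by (auto simp: pv)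
    qed
    then obtain t where "t \<in> N" "(g, x) \<in> \<beta> t" "(g, y) \<in> \<beta> t" by blast
    then have "t \<in> trace g A \<inter> trace g B" using xy by (auto simp: trace_def)
    then show ?thesis by blast
  qed
  have "\<exists>c. c \<in> N \<and> (\<forall>B\<in>\<B>. c \<in> trace g B)" if g: "g \<in> pverts G" for g
  proof -
    have "finite \<B>" using \<B> finH by (auto simp: bramble_def intro: finite_subset[of _ "Pow (pverts H)"])
    moreover have "N \<inter> trace g B \<noteq> {}" if "B \<in> \<B>" for B
      using trace_meet[OF g that that] by (auto simp: trace_def)
    \<comment> \<open>\<open>N\<close> serves as the distinguished set of the Helly property, so a
      node is found even for an empty bramble.\<close>
    ultimately have "N \<inter> \<Inter>(trace g ` \<B>) \<noteq> {}"
      using trace_conn[OF g] trace_meet[OF g] N by (intro ctree_Helly[OF T]) auto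
    then show ?thesis by blast
  qed
  then have "\<forall>g\<in>pverts G. \<exists>c. c \<in> N \<and> (\<forall>B\<in>\<B>. c \<in> trace g B)" by blast
  then obtain c where "\<forall>g\<in>pverts G. c g \<in> N \<and> (\<forall>B\<in>\<B>. c g \<in> trace g B)"
    by (rule bchoice[THEN exE])
  then have c: "c g \<in> N" "\<And>B. B \<in> \<B> \<Longrightarrow> c g \<in> trace g B" if "g \<in> pverts G" for g
    using that by blast+
  \<comment> \<open>\<open>R g\<close> is the part of the tree reachable from \<open>c g\<close> along edges whose adhesion set contains at
    least \<open>l / 2\<close> vertices of the copy \<open>{g} \<times> H\<close>.\<close>
  define Fg where "Fg g = {(s, t) \<in> F. l \<le> 2 * card (w g s \<inter> w g t)}" for g
  define R where "R g = component (Fg g) N (c g)" for g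
  have symFg: "sym (Fg g)" for g
    using N(4) by (auto simp: Fg_def sym_def Int_commute)
  have RN: "R g \<subseteq> N" and Rc: "c g \<in> R g" if "g \<in> pverts G" for g
    unfolding R_def using component_subset[OF c(1)[OF that]] by simp_all
  have Rconn: "conn F (R g)" for g
    by (rule conn_mono[OF conn_component[OF symFg, of g N "c g"], folded R_def]) (auto simp: Fg_def)
  have Rstep: "t \<in> R g"
    if "g \<in> pverts G" "s \<in> R g" "(s, t) \<in> F" "l \<le> 2 * card (w g s \<inter> w g t)" for g s t
  proof -
    have "(s, t) \<in> Fg g" using that by (simp add: Fg_def)
    then show ?thesis unfolding R_def
      using that component_step[of s "Fg g" N "c g" t] N(3) by (auto simp: R_def)
  qed
  \<comment> \<open>At \<open>c g\<close> the slice covers the bramble and has at least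
    \<open>l\<close> elements; any other node is reached by an edge whose adhesion set already
    supplies half of that.\<close>
  have heavy: "l \<le> 2 * card (w g t)" if g: "g \<in> pverts G" and t: "t \<in> R g" for g t
  proof (cases "t = c g")
    case True
    have "w g t \<inter> B \<noteq> {}" if "B \<in> \<B>" for B
      using c(2)[OF g that] by (auto simp: trace_def w_def True)
    then have "covers (w g t) \<B>" by (simp add: covers_def)
    then have "l \<le> card (w g t)" using order[OF wH] RN[OF g] t by blast
    then show ?thesis by simp
  next
    case False
    from t have "(c g, t) \<in> (Fg g \<inter> N \<times> N)\<^sup>*" by (simp add: R_def component_def)
    then obtain s where "(s, t) \<in> Fg g" using False by (auto elim: rtranclE)
    then have "l \<le> 2 * card (w g s \<inter> w g t)" by (simp add: Fg_def)
    moreover have "card (w g s \<inter> w g t) \<le> card (w g t)"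
      using finw RN[OF g] t by (intro card_mono) auto
    ultimately show ?thesis by linarith
  qed
  \<comment> \<open>The component \<open>D\<close> of \<open>N - R g\<close> around \<open>p\<close>
    contains \<open>P\<close>. Some edge \<open>ab\<close> leads from \<open>R g\<close> into
    \<open>D\<close>; its adhesion set is small, or \<open>b\<close> would belong to
    \<open>R g\<close>. Cutting \<open>ab\<close> separates \<open>R g\<close> from
    \<open>P\<close>.\<close>
  have escape: "\<exists>a b S. a \<in> R g \<and> 2 * card (w g a \<inter> w g b) < l \<and> a \<in> N \<and>
      R g \<subseteq> S \<and> P \<inter> S = {} \<and> (\<forall>x y. (x, y) \<in> F \<longrightarrow> x \<in> S \<longrightarrow> y \<notin> S \<longrightarrow> x = a \<and> y = b)"
    if g: "g \<in> pverts G" and P: "conn F P" "P \<subseteq> N" "p \<in> P" "P \<inter> R g = {}" for g P p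
  proof -
    define D where "D = component F (N - R g) p"
    have pD: "p \<in> N - R g" using P by blast
    have D: "D \<subseteq> N - R g" "p \<in> D" "conn F D"
      unfolding D_def using component_subset[OF pD] conn_component[OF N(4)] by auto
    have Dstep: "y \<in> D" if "x \<in> D" "(x, y) \<in> F" "y \<notin> R g" for x y
      using component_step[of x F "N - R g" p y] that D(1) N(3) unfolding D_def by blast
    have PD: "P \<subseteq> D"
    proof (rule ccontr)
      assume "\<not> P \<subseteq> D"
      then obtain q where "q \<in> P" "q \<notin> D" by blast
      then obtain x y where "x \<in> D" "y \<in> P" "y \<notin> D" "(x, y) \<in> F"
        using connD[OF P(1,3) D(2)] by metis
      then show False using Dstep P(4) by blast
    qed
    have "c g \<notin> D" using D(1) Rc[OF g] by blast
    then obtain b a where ba: "b \<in> D" "a \<notin> D" "(b, a) \<in> F"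
      using connD[OF N(5) _ D(2) c(1)[OF g]] pD by blast
    have a: "a \<in> R g" using Dstep ba by blast
    have b: "b \<notin> R g" using ba D(1) by blast
    have ab: "(a, b) \<in> F" using ba(3) N(4) by (blast dest: symD)
    obtain S where cut: "\<forall>x y. (x, y) \<in> F \<longrightarrow> x \<in> S \<longrightarrow> y \<notin> S \<longrightarrow> x = a \<and> y = b"
      and S: "\<forall>A. conn F A \<longrightarrow> a \<in> A \<longrightarrow> b \<notin> A \<longrightarrow> A \<subseteq> S"
        "\<forall>A. conn F A \<longrightarrow> b \<in> A \<longrightarrow> a \<notin> A \<longrightarrow> A \<inter> S = {}"
      by (rule ctree_cut[OF T ab]) blast
    have "R g \<subseteq> S" using S(1) Rconn a b by blast
    moreover have "P \<inter> S = {}" using S(2) D(3) ba(1,2) PD by blast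
    moreover have "2 * card (w g a \<inter> w g b) < l"
      using Rstep[OF g a ab] b by linarith
    moreover have "a \<in> N" using a RN[OF g] by blast
    ultimately show ?thesis using a cut by blast
  qed
  have meet: "R g \<inter> R g' \<noteq> {}" if gg: "(g, g') \<in> parcs G" for g g'
  proof
    assume disj: "R g \<inter> R g' = {}"
    have g: "g \<in> pverts G" and g': "g' \<in> pverts G" using gg vertsG by auto
    \<comment> \<open>Both escaping edges carry fewer than \<open>l / 2\<close> vertices, so some bramble member \<open>B\<close> avoids both
      adhesion sets. Then \<open>{g} \<times> B\<close> and \<open>{g'} \<times> B\<close> live on disjoint sides of the tree although they
      are joined by an edge.\<close>
    obtain a b S where a: "a \<in> R g" "2 * card (w g a \<inter> w g b) < l" "a \<in> N"
      and S: "R g \<subseteq> S" "R g' \<inter> S = {}"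
      and cut: "\<And>x y. (x, y) \<in> F \<Longrightarrow> x \<in> S \<Longrightarrow> y \<notin> S \<Longrightarrow> x = a \<and> y = b"
      using escape[OF g Rconn RN[OF g'] Rc[OF g']] disj by (metis Int_commute)
    obtain a' b' S' where a': "a' \<in> R g'" "2 * card (w g' a' \<inter> w g' b') < l" "a' \<in> N"
      and S': "R g' \<subseteq> S'" "R g \<inter> S' = {}"
      and cut': "\<And>x y. (x, y) \<in> F \<Longrightarrow> x \<in> S' \<Longrightarrow> y \<notin> S' \<Longrightarrow> x = a' \<and> y = b'"
      using escape[OF g' Rconn RN[OF g] Rc[OF g]] disj by metis
    define X where "X = (w g a \<inter> w g b) \<union> (w g' a' \<inter> w g' b')"
    have "card X \<le> card (w g a \<inter> w g b) + card (w g' a' \<inter> w g' b')"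
      unfolding X_def by (rule card_Un_le)
    then have "card X < l" using a(2) a'(2) by linarith
    moreover have "X \<subseteq> pverts H" using wH[OF a(3)] wH[OF a'(3)] by (auto simp: X_def)
    ultimately have "\<not> covers X \<B>" using order[of X] by linarith
    then obtain B where B: "B \<in> \<B>" "X \<inter> B = {}" by (auto simp: covers_def)
    \<comment> \<open>The only possible exit from \<open>Q\<close> is the edge \<open>xy\<close>,
      whose adhesion set misses \<open>{f} \<times> B\<close>; so the trace stays on the side of
      \<open>c f\<close>.\<close>
    have side: "trace f B \<subseteq> Q"
      if f: "f \<in> pverts G" "R f \<subseteq> Q" "w f x \<inter> w f y \<inter> B = {}"
        and Q: "\<And>p q. (p, q) \<in> F \<Longrightarrow> p \<in> Q \<Longrightarrow> q \<notin> Q \<Longrightarrow> p = x \<and> q = y" for f x y Q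
    proof -
      have "trace f B \<subseteq> Q \<or> trace f B \<inter> Q = {}"
        unfolding trace_def
      proof (rule tdec_separation[OF td copy[OF f(1) B(1)]])
        fix p q assume "p \<in> Q" "q \<in> N - Q" "(p, q) \<in> F"
        then have "p = x" "q = y" using Q by blast+
        then show "\<beta> p \<inter> \<beta> q \<inter> ({f} \<times> B) = {}" using f(3) by (auto simp: w_def)
      qed
      moreover have "c f \<in> trace f B \<inter> Q" using c(2)[OF f(1) B(1)] Rc[OF f(1)] f(2) by blast
      ultimately show ?thesis by blast
    qed
    have tS: "trace g B \<subseteq> S" by (rule side[OF g S(1) _ cut]) (use B in \<open>auto simp: X_def\<close>)
    have tS': "trace g' B \<subseteq> S'" by (rule side[OF g' S'(1) _ cut']) (use B in \<open>auto simp: X_def\<close>)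
    have "B \<noteq> {}" "B \<subseteq> pverts H" using \<B> B(1) by (auto simp: bramble_def)
    then obtain h where h: "h \<in> B" "h \<in> pverts H" by blast
    have "((g, h), (g', h)) \<in> parcs (G \<box> H)" using gg h by (simp add: cartesian_product_def)
    then obtain t where t: "t \<in> N" "(g, h) \<in> \<beta> t" "(g', h) \<in> \<beta> t"
      using tdecD(5)[OF td, of "(g, h)" "(g', h)"] g g' h by (auto simp: pv)
    then have "t \<in> S \<inter> S'" using tS tS' h by (auto simp: trace_def)
    \<comment> \<open>Some edge must leave \<open>S \<inter> S'\<close>, and as an exit from
      \<open>S\<close> or from \<open>S'\<close> it starts at \<open>a\<close> or at
      \<open>a'\<close>. But \<open>a\<close> lies outside \<open>S'\<close> and \<open>a'\<close>
      outside \<open>S\<close>.\<close>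
    moreover have "c g \<notin> S \<inter> S'" using S' Rc[OF g] by blast
    ultimately obtain p q where "p \<in> S \<inter> S'" "q \<notin> S \<inter> S'" "(p, q) \<in> F"
      using connD[OF N(5) t(1) _ c(1)[OF g]] by metis
    then have "p = a \<and> p \<in> S' \<or> p = a' \<and> p \<in> S" using cut cut' by blast
    then show False using a(1) a'(1) S S' by blast
  qed
  define \<gamma> where "\<gamma> t = {g \<in> pverts G. t \<in> R g}" for t
  have nodes: "{t \<in> N. g \<in> \<gamma> t} = R g" if "g \<in> pverts G" for g
    using RN[OF that] that by (auto simp: \<gamma>_def)
  have "tdec (pverts G) (parcs G) N F \<gamma>"
    unfolding tdec_def
  proof (intro conjI ballI impI)
    show "\<exists>t\<in>N. u \<in> \<gamma> t \<and> v \<in> \<gamma> t" if "u \<in> pverts G" "v \<in> pverts G" "(u, v) \<in> parcs G" for u v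
      using meet[OF that(3)] that RN[OF that(1)] by (auto simp: \<gamma>_def)
    show "{t \<in> N. v \<in> \<gamma> t} \<noteq> {}" "conn F {t \<in> N. v \<in> \<gamma> t}" if "v \<in> pverts G" for v
      using Rc[OF that] Rconn by (auto simp only: nodes[OF that])
  qed (use T in \<open>auto simp: \<gamma>_def\<close>)
  moreover have "card (\<gamma> t) * l \<le> 2 * card (\<beta> t)" if t: "t \<in> N" for t
  proof -
    have fin: "finite (\<gamma> t)" using finG by (simp add: \<gamma>_def)
    have "card (\<gamma> t) * l = (\<Sum>g\<in>\<gamma> t. l)" by simp
    also have "\<dots> \<le> (\<Sum>g\<in>\<gamma> t. 2 * card (w g t))"
      using heavy by (intro sum_mono) (auto simp: \<gamma>_def)
    \<comment> \<open>Slices for different \<open>g\<close> are disjoint parts of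
      \<open>\<beta> t\<close>, so their sizes add up.\<close>
    also have "\<dots> = 2 * card (SIGMA g:\<gamma> t. w g t)"
      using fin finw[OF t] by (simp add: card_SigmaI sum_distrib_left)
    also have "card (SIGMA g:\<gamma> t. w g t) \<le> card (\<beta> t)"
    proof (rule card_mono)
      have "finite (pverts (G \<box> H))" using finG finH by (simp add: pv)
      then show "finite (\<beta> t)" using tdecD(2)[OF td t] by (rule rev_finite_subset)
    qed (auto simp: w_def)
    finally show ?thesis by simp
  qed
  ultimately show ?thesis by blast
qed

section \<open>From treewidth to brambles, and the product inequality\<close>

text \<open>Contrapositive of \<open>bramble_duality\<close> with \<open>k = l - 1\<close>. The case
  \<open>l = 0\<close> stands apart because truncated subtraction would give \<open>k = 0\<close>,
  hence only treewidth at most \<open>-1\<close>, which contradicts nothing; there the empty bramble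
  suffices.\<close>

lemma bramble_of_treewidth:
  assumes H: "pair_graph H" and l: "int l \<le> treewidth H + 1"
  obtains \<B> where "bramble (pverts H) (parcs H) \<B>"
    "\<And>X. X \<subseteq> pverts H \<Longrightarrow> covers X \<B> \<Longrightarrow> l \<le> card X"
proof (cases "l = 0")
  case True
  then show ?thesis using that[of "{}"] by (simp add: bramble_def)
next
  case False
  note witness = that
  show ?thesis
  proof (rule ccontr)
    assume no: "\<not> thesis"
    have "\<exists>X\<subseteq>pverts H. covers X \<B> \<and> card X \<le> l - 1"
      if B: "bramble (pverts H) (parcs H) \<B>" for \<B>
    proof (rule ccontr)
      assume none: "\<not> ?thesis"
      have "l \<le> card X" if "X \<subseteq> pverts H" "covers X \<B>" for X
      proof (rule ccontr)
        assume "\<not> l \<le> card X"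
        then have "card X \<le> l - 1" by linarith
        with none that show False by blast
      qed
      then show False using no witness[OF B] by blast
    qed
    then obtain N :: "nat set" and F \<beta> where td: "tdec (pverts H) (parcs H) N F \<beta>"
      and small: "\<forall>t\<in>N. card (\<beta> t) \<le> l - 1"
      using bramble_duality[OF pair_graphD(1,3)[OF H]] by blast
    let ?T = "\<lparr>pverts = N, parcs = F\<rparr>"
    note N = ctreeD[OF tdecD(1)[OF td]]
    have "tree_decomposition H ?T \<beta>" using td H by (simp add: tree_decomposition_iff_tdec)
    then have "treewidth H \<le> decomposition_width ?T \<beta>" by (rule treewidth_le)
    moreover have "int (card (\<beta> t)) \<le> int (l - 1)" if "t \<in> N" for t
      using small that by simp
    then have "(MAX t\<in>N. int (card (\<beta> t))) \<le> int (l - 1)" using N by simp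
    ultimately show False using l False by (simp add: decomposition_width_def)
  qed
qed

theorem theorem3:
  fixes G :: "'a pair_pre_digraph" and H :: "'b pair_pre_digraph"
  assumes "pair_graph G" and "pair_graph H"
  shows "real_of_int (treewidth (G \<box> H)) \<ge>
    1 / 2 * (real_of_int (treewidth G) + 1) * (real_of_int (treewidth H) + 1) - 1"
proof -
  have GH: "pair_graph (G \<box> H)" using assms by (rule pair_graph_cartesian_product)
  obtain TH :: "nat pair_pre_digraph" and \<beta>H
    where "tree_decomposition H TH \<beta>H" "treewidth H = decomposition_width TH \<beta>H"
    using treewidth_attained[OF assms(2)] .
  then have "- 1 \<le> treewidth H" using decomposition_width_ge by metis
  \<comment> \<open>A graph \<open>H\<close> without vertices has treewidth \<open>-1\<close>, which
    gives \<open>l = 0\<close>.\<close>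
  then obtain l where l: "treewidth H + 1 = int l"
    using nonneg_int_cases[of "treewidth H + 1"] by auto
  obtain \<B> where \<B>: "bramble (pverts H) (parcs H) \<B>"
    "\<And>X. X \<subseteq> pverts H \<Longrightarrow> covers X \<B> \<Longrightarrow> l \<le> card X"
    using bramble_of_treewidth[OF assms(2), of l] l by auto
  obtain T :: "nat pair_pre_digraph" and \<beta> where T: "tree_decomposition (G \<box> H) T \<beta>"
    and tw: "treewidth (G \<box> H) = decomposition_width T \<beta>"
    using treewidth_attained[OF GH] .
  obtain \<gamma> where \<gamma>: "tdec (pverts G) (parcs G) (pverts T) (parcs T) \<gamma>"
    and bags: "\<forall>t\<in>pverts T. card (\<gamma> t) * l \<le> 2 * card (\<beta> t)"
    using product_tdec_project[OF assms \<B> T[unfolded tree_decomposition_iff_tdec[OF GH]]] by blast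
  note N = ctreeD[OF tdecD(1)[OF \<gamma>]]
  have "tree_decomposition G T \<gamma>" using \<gamma> assms(1) by (simp add: tree_decomposition_iff_tdec)
  then have "treewidth G \<le> decomposition_width T \<gamma>" by (rule treewidth_le)
  moreover have "(MAX t\<in>pverts T. int (card (\<gamma> t))) \<in> (\<lambda>t. int (card (\<gamma> t))) ` pverts T"
    using N by (intro Max_in) auto
  then obtain t where t: "t \<in> pverts T" "(MAX t\<in>pverts T. int (card (\<gamma> t))) = int (card (\<gamma> t))"
    by auto
  ultimately have "treewidth G + 1 \<le> int (card (\<gamma> t))" by (simp add: decomposition_width_def)
  then have "(treewidth G + 1) * int l \<le> int (card (\<gamma> t)) * int l" by (simp add: mult_right_mono)
  also have "\<dots> \<le> 2 * int (card (\<beta> t))"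
    using bags t(1) by (metis of_nat_mult of_nat_le_iff of_nat_numeral)
  also have "int (card (\<beta> t)) \<le> treewidth (G \<box> H) + 1"
    using N t(1) by (simp add: tw decomposition_width_def)
  finally have "(treewidth G + 1) * (treewidth H + 1) \<le> 2 * (treewidth (G \<box> H) + 1)"
    by (simp add: l)
  then have "real_of_int ((treewidth G + 1) * (treewidth H + 1)) \<le> real_of_int (2 * (treewidth (G \<box> H) + 1))"
    by (simp only: of_int_le_iff)
  then show ?thesis by simp
qed

end
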